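(* (1) The theory $SA$ is interpretable in $Ar+(AC!)$: there is a translation $\varphi\mapsto\varphi^\wedge$ of formulas of $SA$ into formulas of $Ar$ such that $SA\vdash\varphi$ implies $Ar+(AC!)\vdash\overline{\overline{\varphi}}^\wedge$ (where $\overline{\overline{\varphi}}$ is the universal closure of $\varphi$). (2) The theory $Ar+(AC!)$ is a subtheory of $Ar+(\Delta^1_1\text{-}C)$, i.e. every theorem of $Ar+(AC!)$ is a theorem of $Ar+(\Delta^1_1\text{-}C)$.
   Context: Fix a standard numbering of pairs of natural numbers, $(m,n)$ denoting the number of the pair $m,n$. $SA$: a classical many-sorted second-order arithmetic. Variables: numerical variables $n_1,n_2,\ldots,m,n,\ldots$, and for each $k\geqslant1$ set variables $x_1^{(k)},x_2^{(k)},\ldots$ of sort $k$. Constants $0,1$, function symbols $+,\cdot$, predicate symbols $=$ (for numbers) and $\in_k$ $(k\geqslant1)$. Atomic formulas: $t=\tau$ and $t\in_k x^{(k)}$ for numerical terms $t,\tau$; formulas built with $\bot$, connectives, quantifiers. A formula is $k$-simple if it has no quantifiers over set variables and no variables of sort $>k$. Axioms: classical predicate logic with equality; Peano axioms $\neg(n+1=0)$, $n+1=m+1\supset n=m$, $n+0=n$, $n+(m+1)=(n+m)+1$, $n\cdot0=0$, $n\cdot(m+1)=n\cdot m+n$; induction $\varphi(0)\wedge\forall n[\varphi(n)\supset\varphi(n+1)]\supset\forall n\varphi(n)$ for every formula $\varphi$; comprehension $\exists z^{(k)}\forall n(n\in z\equiv\varphi(n))$ for $k$-simple $\varphi$ not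 containing $z^{(k)}$; choice $\forall n\exists!x^{(k)}\varphi(n,x)\supset\exists y^{(k+1)}\forall n\exists x^{(k)}[\varphi(n,x)\wedge\forall m(m\in x\equiv(n,m)\in y)]$ for $k$-simple $\varphi$ (uniqueness being with respect to $x=_ky:=\forall n(n\in_kx\equiv n\in_ky)$). $Ar$: classical second-order arithmetic with numerical variables and one sort of set variables $x,y,\ldots$, constants $0,1$, symbols $+,\cdot,=,\in$; axioms: classical logic with equality, the Peano axioms above, induction for all formulas, and comprehension $\exists z\forall n(n\in z\equiv\varphi(n))$ for $\varphi$ without set quantifiers not containing $z$. Set equality $x=y:=\forall n(n\in x\equiv n\in y)$. $(AC!)$: $\forall k\exists!x\varphi(k,x)\supset\exists y\forall k\exists x[\varphi(k,x)\wedge\forall m(m\in x\equiv(k,m)\in y)]$, for $\varphi$ without set quantifiers not containing $y$. $(\Delta^1_1\text{-}C)$: $\forall n[\forall v\varphi(n,v)\equiv\exists u\psi(n,u)]\supset\exists z\forall n[n\in z\equiv\exists u\psi(n,u)]$, for $\varphi,\psi$ without set quantifiers not containing $z$. *)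

theory Defs
  imports Main "HOL-Library.Nat_Bijection"
begin

section \<open>Many-sorted second-order arithmetic\<close>

text \<open>
  Formulas are a deep embedding with de Bruijn indices. There is one index space for numerical
  variables and a separate one for the set variables of each sort \<open>s\<close>; a quantifier over the set
  variables of sort \<open>s\<close> binds index 0 of sort \<open>s\<close> and leaves all the other index spaces alone.
  The type parameter is the type of set sorts: \<^typ>\<open>unit\<close> for \<open>Ar\<close>, \<^typ>\<open>nat\<close> for \<open>SA\<close>.
  In the latter case \<open>k :: nat\<close> stands for the sort \<open>k + 1\<close>, so that the sorts are exactly
  \<open>1, 2, \<dots>\<close>. The set function \<open>sorts\<close> collects the sorts of all free and bound set variables.
\<close>

datatype tm = Var nat | Zero | One | Add tm tm | Mul tm tm

datatype (sorts: 's) fm =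
    Eq tm tm
  | Mem tm 's nat
  | Bot
  | Imp "'s fm" "'s fm"
  | And "'s fm" "'s fm"
  | Or "'s fm" "'s fm"
  | AllN "'s fm"
  | ExN "'s fm"
  | AllS 's "'s fm"
  | ExS 's "'s fm"

type_synonym sa_fm = "nat fm"
type_synonym ar_fm = "unit fm"

definition Neg :: "'s fm \<Rightarrow> 's fm" where
  "Neg \<phi> = Imp \<phi> Bot"

definition Iff :: "'s fm \<Rightarrow> 's fm \<Rightarrow> 's fm" where
  "Iff \<phi> \<psi> = And (Imp \<phi> \<psi>) (Imp \<psi> \<phi>)"


subsection \<open>Substitution\<close>

primrec tsubst :: "(nat \<Rightarrow> tm) \<Rightarrow> tm \<Rightarrow> tm" where
  "tsubst \<sigma> (Var i) = \<sigma> i"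
| "tsubst \<sigma> Zero = Zero"
| "tsubst \<sigma> One = One"
| "tsubst \<sigma> (Add t u) = Add (tsubst \<sigma> t) (tsubst \<sigma> u)"
| "tsubst \<sigma> (Mul t u) = Mul (tsubst \<sigma> t) (tsubst \<sigma> u)"

definition tshift :: "tm \<Rightarrow> tm" where
  "tshift = tsubst (\<lambda>i. Var (Suc i))"

text \<open>Adjusting a simultaneous substitution when it passes a quantifier.\<close>

definition upN :: "(nat \<Rightarrow> tm) \<Rightarrow> nat \<Rightarrow> tm" where
  "upN \<sigma> i = (case i of 0 \<Rightarrow> Var 0 | Suc j \<Rightarrow> tshift (\<sigma> j))"

definition upS :: "'s \<Rightarrow> ('s \<Rightarrow> nat \<Rightarrow> nat) \<Rightarrow> 's \<Rightarrow> nat \<Rightarrow> nat" where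
  "upS s \<rho> s' i = (if s' = s then (case i of 0 \<Rightarrow> 0 | Suc j \<Rightarrow> Suc (\<rho> s j)) else \<rho> s' i)"

primrec subst :: "(nat \<Rightarrow> tm) \<Rightarrow> ('s \<Rightarrow> nat \<Rightarrow> nat) \<Rightarrow> 's fm \<Rightarrow> 's fm" where
  "subst \<sigma> \<rho> (Eq t u) = Eq (tsubst \<sigma> t) (tsubst \<sigma> u)"
| "subst \<sigma> \<rho> (Mem t s i) = Mem (tsubst \<sigma> t) s (\<rho> s i)"
| "subst \<sigma> \<rho> Bot = Bot"
| "subst \<sigma> \<rho> (Imp \<phi> \<psi>) = Imp (subst \<sigma> \<rho> \<phi>) (subst \<sigma> \<rho> \<psi>)"
| "subst \<sigma> \<rho> (And \<phi> \<psi>) = And (subst \<sigma> \<rho> \<phi>) (subst \<sigma> \<rho> \<psi>)"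
| "subst \<sigma> \<rho> (Or \<phi> \<psi>) = Or (subst \<sigma> \<rho> \<phi>) (subst \<sigma> \<rho> \<psi>)"
| "subst \<sigma> \<rho> (AllN \<phi>) = AllN (subst (upN \<sigma>) \<rho> \<phi>)"
| "subst \<sigma> \<rho> (ExN \<phi>) = ExN (subst (upN \<sigma>) \<rho> \<phi>)"
| "subst \<sigma> \<rho> (AllS s \<phi>) = AllS s (subst \<sigma> (upS s \<rho>) \<phi>)"
| "subst \<sigma> \<rho> (ExS s \<phi>) = ExS s (subst \<sigma> (upS s \<rho>) \<phi>)"

definition shS :: "'s \<Rightarrow> 's \<Rightarrow> nat \<Rightarrow> nat" where
  "shS s s' i = (if s' = s then Suc i else i)"

definition liftN :: "'s fm \<Rightarrow> 's fm" where
  "liftN = subst (\<lambda>i. Var (Suc i)) (\<lambda>_ i. i)"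

definition liftS :: "'s \<Rightarrow> 's fm \<Rightarrow> 's fm" where
  "liftS s = subst Var (shS s)"

definition instN :: "tm \<Rightarrow> 's fm \<Rightarrow> 's fm" where
  "instN t = subst (\<lambda>i. case i of 0 \<Rightarrow> t | Suc j \<Rightarrow> Var j) (\<lambda>_ i. i)"

definition instS :: "'s \<Rightarrow> nat \<Rightarrow> 's fm \<Rightarrow> 's fm" where
  "instS s i = subst Var (\<lambda>s' j. if s' = s then (case j of 0 \<Rightarrow> i | Suc j' \<Rightarrow> j') else j)"


subsection \<open>Free variables and universal closure\<close>

text \<open>
  \<open>nfree \<phi>\<close> is the least \<open>n\<close> such that every free numerical index of \<open>\<phi>\<close> is below \<open>n\<close>;
  \<open>sfree s \<phi>\<close> is the analogous bound for the set variables of sort \<open>s\<close>.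
\<close>

primrec tfree :: "tm \<Rightarrow> nat" where
  "tfree (Var i) = Suc i"
| "tfree Zero = 0"
| "tfree One = 0"
| "tfree (Add t u) = max (tfree t) (tfree u)"
| "tfree (Mul t u) = max (tfree t) (tfree u)"

primrec nfree :: "'s fm \<Rightarrow> nat" where
  "nfree (Eq t u) = max (tfree t) (tfree u)"
| "nfree (Mem t s i) = tfree t"
| "nfree Bot = 0"
| "nfree (Imp \<phi> \<psi>) = max (nfree \<phi>) (nfree \<psi>)"
| "nfree (And \<phi> \<psi>) = max (nfree \<phi>) (nfree \<psi>)"
| "nfree (Or \<phi> \<psi>) = max (nfree \<phi>) (nfree \<psi>)"
| "nfree (AllN \<phi>) = nfree \<phi> - 1"
| "nfree (ExN \<phi>) = nfree \<phi> - 1"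
| "nfree (AllS s \<phi>) = nfree \<phi>"
| "nfree (ExS s \<phi>) = nfree \<phi>"

primrec sfree :: "'s \<Rightarrow> 's fm \<Rightarrow> nat" where
  "sfree s (Eq t u) = 0"
| "sfree s (Mem t s' i) = (if s' = s then Suc i else 0)"
| "sfree s Bot = 0"
| "sfree s (Imp \<phi> \<psi>) = max (sfree s \<phi>) (sfree s \<psi>)"
| "sfree s (And \<phi> \<psi>) = max (sfree s \<phi>) (sfree s \<psi>)"
| "sfree s (Or \<phi> \<psi>) = max (sfree s \<phi>) (sfree s \<psi>)"
| "sfree s (AllN \<phi>) = sfree s \<phi>"
| "sfree s (ExN \<phi>) = sfree s \<phi>"
| "sfree s (AllS s' \<phi>) = (if s' = s then sfree s \<phi> - 1 else sfree s \<phi>)"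
| "sfree s (ExS s' \<phi>) = (if s' = s then sfree s \<phi> - 1 else sfree s \<phi>)"

definition closure :: "('s::linorder) fm \<Rightarrow> 's fm" where
  "closure \<phi> =
     fold (\<lambda>s. AllS s ^^ sfree s \<phi>) (sorted_list_of_set (sorts \<phi>)) ((AllN ^^ nfree \<phi>) \<phi>)"


subsection \<open>Classical logic with equality\<close>

text \<open>
  Natural deduction: the formulas in \<open>T\<close> are axioms, so they may be used with their free variables
  generalised; the formulas in the list \<open>\<Gamma>\<close> are hypotheses.
\<close>

inductive derives :: "'s fm set \<Rightarrow> 's fm list \<Rightarrow> 's fm \<Rightarrow> bool" for T where
  Ax: "\<phi> \<in> T \<Longrightarrow> derives T \<Gamma> \<phi>"
| Hyp: "\<phi> \<in> set \<Gamma> \<Longrightarrow> derives T \<Gamma> \<phi>"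
| ImpI: "derives T (\<phi> # \<Gamma>) \<psi> \<Longrightarrow> derives T \<Gamma> (Imp \<phi> \<psi>)"
| ImpE: "derives T \<Gamma> (Imp \<phi> \<psi>) \<Longrightarrow> derives T \<Gamma> \<phi> \<Longrightarrow> derives T \<Gamma> \<psi>"
| AndI: "derives T \<Gamma> \<phi> \<Longrightarrow> derives T \<Gamma> \<psi> \<Longrightarrow> derives T \<Gamma> (And \<phi> \<psi>)"
| AndE1: "derives T \<Gamma> (And \<phi> \<psi>) \<Longrightarrow> derives T \<Gamma> \<phi>"
| AndE2: "derives T \<Gamma> (And \<phi> \<psi>) \<Longrightarrow> derives T \<Gamma> \<psi>"
| OrI1: "derives T \<Gamma> \<phi> \<Longrightarrow> derives T \<Gamma> (Or \<phi> \<psi>)"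
| OrI2: "derives T \<Gamma> \<psi> \<Longrightarrow> derives T \<Gamma> (Or \<phi> \<psi>)"
| OrE: "derives T \<Gamma> (Or \<phi> \<psi>) \<Longrightarrow> derives T (\<phi> # \<Gamma>) \<chi> \<Longrightarrow> derives T (\<psi> # \<Gamma>) \<chi>
        \<Longrightarrow> derives T \<Gamma> \<chi>"
| Classical: "derives T (Neg \<phi> # \<Gamma>) Bot \<Longrightarrow> derives T \<Gamma> \<phi>"
| AllNI: "derives T (map liftN \<Gamma>) \<phi> \<Longrightarrow> derives T \<Gamma> (AllN \<phi>)"
| AllNE: "derives T \<Gamma> (AllN \<phi>) \<Longrightarrow> derives T \<Gamma> (instN t \<phi>)"
| ExNI: "derives T \<Gamma> (instN t \<phi>) \<Longrightarrow> derives T \<Gamma> (ExN \<phi>)"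
| ExNE: "derives T \<Gamma> (ExN \<phi>) \<Longrightarrow> derives T (\<phi> # map liftN \<Gamma>) (liftN \<psi>) \<Longrightarrow> derives T \<Gamma> \<psi>"
| AllSI: "derives T (map (liftS s) \<Gamma>) \<phi> \<Longrightarrow> derives T \<Gamma> (AllS s \<phi>)"
| AllSE: "derives T \<Gamma> (AllS s \<phi>) \<Longrightarrow> derives T \<Gamma> (instS s i \<phi>)"
| ExSI: "derives T \<Gamma> (instS s i \<phi>) \<Longrightarrow> derives T \<Gamma> (ExS s \<phi>)"
| ExSE: "derives T \<Gamma> (ExS s \<phi>) \<Longrightarrow> derives T (\<phi> # map (liftS s) \<Gamma>) (liftS s \<psi>)
        \<Longrightarrow> derives T \<Gamma> \<psi>"
| EqRefl: "derives T \<Gamma> (Eq t t)"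
| EqSubst: "derives T \<Gamma> (Eq t u) \<Longrightarrow> derives T \<Gamma> (instN t \<phi>) \<Longrightarrow> derives T \<Gamma> (instN u \<phi>)"

definition provable :: "'s fm set \<Rightarrow> 's fm \<Rightarrow> bool" (infix "\<turnstile>" 50) where
  "T \<turnstile> \<phi> \<longleftrightarrow> derives T [] \<phi>"


subsection \<open>Axioms\<close>

definition peano :: "'s fm set" where
  "peano =
    {Neg (Eq (Add (Var 0) One) Zero),
     Imp (Eq (Add (Var 0) One) (Add (Var 1) One)) (Eq (Var 0) (Var 1)),
     Eq (Add (Var 0) Zero) (Var 0),
     Eq (Add (Var 0) (Add (Var 1) One)) (Add (Add (Var 0) (Var 1)) One),
     Eq (Mul (Var 0) Zero) Zero,
     Eq (Mul (Var 0) (Add (Var 1) One)) (Add (Mul (Var 0) (Var 1)) (Var 0))}"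

text \<open>
  In the schemes below the distinguished numerical variable of \<open>\<phi>\<close> is index 0, and so is the
  distinguished set variable. All other free variables of \<open>\<phi>\<close> are parameters. The condition that
  \<open>\<phi>\<close> does not contain the new set variable is expressed by shifting \<open>\<phi>\<close> past its binder.
\<close>

definition induction_ax :: "'s fm \<Rightarrow> 's fm" where
  "induction_ax \<phi> =
    Imp (And (instN Zero \<phi>)
             (AllN (Imp \<phi>
               (subst (\<lambda>i. case i of 0 \<Rightarrow> Add (Var 0) One | Suc j \<Rightarrow> Var (Suc j)) (\<lambda>_ i. i) \<phi>))))
        (AllN \<phi>)"

definition comprehension_ax :: "'s \<Rightarrow> 's fm \<Rightarrow> 's fm" where
  "comprehension_ax s \<phi> = ExS s (AllN (Iff (Mem (Var 0) s 0) (liftS s \<phi>)))"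

definition set_eq :: "'s \<Rightarrow> nat \<Rightarrow> nat \<Rightarrow> 's fm" where
  "set_eq s i j = AllN (Iff (Mem (Var 0) s i) (Mem (Var 0) s j))"

text \<open>
  \<open>\<exists>!x \<phi>(x)\<close> is \<open>\<exists>x (\<phi>(x) \<and> \<forall>x' (\<phi>(x') \<longrightarrow> x' = x))\<close>; in the inner copy of \<open>\<phi>\<close> the index 0 stays
  with the innermost quantifier and only the parameters are shifted.
\<close>

definition Ex1S :: "'s \<Rightarrow> 's fm \<Rightarrow> 's fm" where
  "Ex1S s \<phi> = ExS s (And \<phi> (AllS s (Imp (subst Var (upS s (shS s)) \<phi>) (set_eq s 0 1))))"

text \<open>
  \<open>(t, u) \<in> x\<close> for the Cantor numbering \<open>(m, n) = (m + n)(m + n + 1)/2 + m\<close> of pairs, which is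
  \<^const>\<open>prod_encode\<close>.
\<close>

definition pair_mem :: "tm \<Rightarrow> tm \<Rightarrow> 's \<Rightarrow> nat \<Rightarrow> 's fm" where
  "pair_mem t u s i =
    (let t' = tshift t; u' = tshift u in
      ExN (And (Eq (Add (Var 0) (Var 0))
                   (Add (Mul (Add t' u') (Add (Add t' u') One)) (Add t' t')))
               (Mem (Var 0) s i)))"

text \<open>
  Choice from sets \<open>x\<close> of sort \<open>s\<close> to a set \<open>y\<close> of sort \<open>s'\<close>. Below the quantifiers
  \<open>\<exists>y \<forall>n \<exists>x\<close> the variable \<open>y\<close> has index 1 if both sorts coincide, and index 0 otherwise; likewise
  the substitution makes room for \<open>y\<close> in \<open>\<phi>\<close>, while \<open>x\<close> remains at index 0 of sort \<open>s\<close>.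
\<close>

definition choice_ax :: "'s \<Rightarrow> 's \<Rightarrow> 's fm \<Rightarrow> 's fm" where
  "choice_ax s s' \<phi> =
    Imp (AllN (Ex1S s \<phi>))
        (ExS s' (AllN (ExS s
          (And (subst Var (upS s (shS s')) \<phi>)
               (AllN (Iff (Mem (Var 0) s 0)
                          (pair_mem (Var 1) (Var 0) s' (if s = s' then 1 else 0))))))))"

definition delta11_ax :: "'s \<Rightarrow> 's fm \<Rightarrow> 's fm \<Rightarrow> 's fm" where
  "delta11_ax s \<phi> \<psi> =
    Imp (AllN (Iff (AllS s \<phi>) (ExS s \<psi>)))
        (ExS s (AllN (Iff (Mem (Var 0) s 0) (liftS s (ExS s \<psi>)))))"

primrec no_set_quant :: "'s fm \<Rightarrow> bool" where
  "no_set_quant (Eq t u) = True"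
| "no_set_quant (Mem t s i) = True"
| "no_set_quant Bot = True"
| "no_set_quant (Imp \<phi> \<psi>) = (no_set_quant \<phi> \<and> no_set_quant \<psi>)"
| "no_set_quant (And \<phi> \<psi>) = (no_set_quant \<phi> \<and> no_set_quant \<psi>)"
| "no_set_quant (Or \<phi> \<psi>) = (no_set_quant \<phi> \<and> no_set_quant \<psi>)"
| "no_set_quant (AllN \<phi>) = no_set_quant \<phi>"
| "no_set_quant (ExN \<phi>) = no_set_quant \<phi>"
| "no_set_quant (AllS s \<phi>) = False"
| "no_set_quant (ExS s \<phi>) = False"

definition k_simple :: "nat \<Rightarrow> sa_fm \<Rightarrow> bool" where
  "k_simple k \<phi> \<longleftrightarrow> no_set_quant \<phi> \<and> (\<forall>j\<in>sorts \<phi>. j \<le> k)"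


subsection \<open>The theories\<close>

definition SA :: "sa_fm set" where
  "SA = peano \<union> range induction_ax
      \<union> {comprehension_ax k \<phi> |k \<phi>. k_simple k \<phi>}
      \<union> {choice_ax k (Suc k) \<phi> |k \<phi>. k_simple k \<phi>}"

definition Ar :: "ar_fm set" where
  "Ar = peano \<union> range induction_ax \<union> {comprehension_ax () \<phi> |\<phi>. no_set_quant \<phi>}"

definition AC_unique :: "ar_fm set" where
  "AC_unique = {choice_ax () () \<phi> |\<phi>. no_set_quant \<phi>}"

definition Delta11_C :: "ar_fm set" where
  "Delta11_C = {delta11_ax () \<phi> \<psi> |\<phi> \<psi>. no_set_quant \<phi> \<and> no_set_quant \<psi>}"


section \<open>Translations of \<open>SA\<close> into \<open>Ar\<close>\<close>

text \<open>
  A translation is a relative interpretation that keeps the numerical part of the language. It is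
  given by formulas of \<open>Ar\<close>: \<open>dom_of k\<close>, in one set variable, which delimits the sets
  that serve as objects of sort \<open>k\<close>, and \<open>mem_of k\<close>, in one numerical and one set
  variable, which interprets \<open>\<in>\<^sub>k\<close>. It commutes with the connectives and the numerical
  quantifiers and relativises the set quantifiers to the domains.
\<close>

datatype translation = Translation (dom_of: "nat \<Rightarrow> ar_fm") (mem_of: "nat \<Rightarrow> ar_fm")

definition wf_translation :: "translation \<Rightarrow> bool" where
  "wf_translation I \<longleftrightarrow>
    (\<forall>k. nfree (dom_of I k) = 0 \<and> sfree () (dom_of I k) \<le> 1 \<and>
         nfree (mem_of I k) \<le> 1 \<and> sfree () (mem_of I k) \<le> 1)"

text \<open>
  The map \<open>\<rho>\<close> records which set index of \<open>Ar\<close> stands for a set variable of \<open>SA\<close>; since \<open>Ar\<close> has a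
  single index space for sets, passing a quantifier of sort \<open>k\<close> shifts the other sorts as well.
\<close>

definition bind_sort :: "nat \<Rightarrow> (nat \<Rightarrow> nat \<Rightarrow> nat) \<Rightarrow> nat \<Rightarrow> nat \<Rightarrow> nat" where
  "bind_sort k \<rho> k' i =
    (if k' = k then (case i of 0 \<Rightarrow> 0 | Suc j \<Rightarrow> Suc (\<rho> k j)) else Suc (\<rho> k' i))"

primrec trans_env :: "translation \<Rightarrow> (nat \<Rightarrow> nat \<Rightarrow> nat) \<Rightarrow> sa_fm \<Rightarrow> ar_fm" where
  "trans_env I \<rho> (Eq t u) = Eq t u"
| "trans_env I \<rho> (Mem t k i) = subst (\<lambda>_. t) (\<lambda>_ _. \<rho> k i) (mem_of I k)"
| "trans_env I \<rho> Bot = Bot"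
| "trans_env I \<rho> (Imp \<phi> \<psi>) = Imp (trans_env I \<rho> \<phi>) (trans_env I \<rho> \<psi>)"
| "trans_env I \<rho> (And \<phi> \<psi>) = And (trans_env I \<rho> \<phi>) (trans_env I \<rho> \<psi>)"
| "trans_env I \<rho> (Or \<phi> \<psi>) = Or (trans_env I \<rho> \<phi>) (trans_env I \<rho> \<psi>)"
| "trans_env I \<rho> (AllN \<phi>) = AllN (trans_env I \<rho> \<phi>)"
| "trans_env I \<rho> (ExN \<phi>) = ExN (trans_env I \<rho> \<phi>)"
| "trans_env I \<rho> (AllS k \<phi>) = AllS () (Imp (dom_of I k) (trans_env I (bind_sort k \<rho>) \<phi>))"
| "trans_env I \<rho> (ExS k \<phi>) = ExS () (And (dom_of I k) (trans_env I (bind_sort k \<rho>) \<phi>))"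

text \<open>Free set variables of different names or sorts are sent to different set variables of \<open>Ar\<close>.\<close>

definition translate :: "translation \<Rightarrow> sa_fm \<Rightarrow> ar_fm" where
  "translate I = trans_env I (\<lambda>k i. prod_encode (k, i))"

end

theory Submission
  imports Defs "HOL-Library.Countable" "HOL-Library.Countable_Set"
begin

text \<open>
  The natural deduction calculus is complete: every formula true in all structures that satisfy a
  theory \<open>T\<close> containing the Peano axioms is a theorem of \<open>T\<close>. So both parts can be shown in models.

  (1) Let every set be an object of every sort. A model of \<open>Ar + (AC!)\<close>, with its sets taken as the
  objects of each sort, is then a model of \<open>SA\<close>, since formulas without set quantifiers are
  translated to such formulas.

  (2) In a model of \<open>Ar + (\<Delta>\<^sup>1\<^sub>1-C)\<close>, if \<open>\<forall>n \<exists>!x \<phi>(n, x)\<close>, then the choice set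
  \<open>{(n, m) | m \<in> x for the unique x with \<phi>(n, x)}\<close> is \<open>\<Delta>\<^sup>1\<^sub>1\<close>, because the unique \<open>x\<close> can be quantified
  existentially or universally. It codes the choice function since the Cantor numbering of pairs is
  total and injective already in Peano arithmetic.
\<close>


text \<open>Countability of terms and formulas is needed twice: \<open>from_nat\<close> enumerates
  all formulas in \<open>extension\<close>, and the classes of terms are numbered in
  \<open>ex_classification\<close>.\<close>

instance tm :: countable
  by countable_datatype

instance fm :: (countable) countable
  by countable_datatype


section \<open>Substitution\<close>

lemma tsubst_tsubst: "tsubst \<sigma> (tsubst \<tau> t) = tsubst (\<lambda>i. tsubst \<sigma> (\<tau> i)) t"
  by (induction t) auto

lemma tsubst_Var [simp]: "tsubst Var t = t"
  by (induction t) auto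

lemma tsubst_cong: "(\<And>i. i < tfree t \<Longrightarrow> \<sigma> i = \<tau> i) \<Longrightarrow> tsubst \<sigma> t = tsubst \<tau> t"
  by (induction t) auto

lemma upN_Var [simp]: "upN Var = Var"
  by (rule ext) (simp add: upN_def tshift_def split: nat.split)

lemma upS_id [simp]: "upS s (\<lambda>_ i. i) = (\<lambda>_ i. i)"
  by (rule ext)+ (auto simp: upS_def split: nat.split)

lemma tsubst_upN_upN: "tsubst (upN \<sigma>) (upN \<tau> i) = upN (\<lambda>i. tsubst \<sigma> (\<tau> i)) i"
  by (auto simp: upN_def tshift_def tsubst_tsubst split: nat.split)

lemma upS_upS: "upS s \<rho> s' (upS s \<tau> s' i) = upS s (\<lambda>s i. \<rho> s (\<tau> s i)) s' i"
  by (auto simp: upS_def split: nat.split)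

lemma subst_subst:
  "subst \<sigma> \<rho> (subst \<sigma>' \<rho>' \<phi>) = subst (\<lambda>i. tsubst \<sigma> (\<sigma>' i)) (\<lambda>s i. \<rho> s (\<rho>' s i)) \<phi>"
  by (induction \<phi> arbitrary: \<sigma> \<rho> \<sigma>' \<rho>') (simp_all add: tsubst_tsubst tsubst_upN_upN upS_upS)

lemma subst_Var [simp]: "subst Var (\<lambda>_ i. i) \<phi> = \<phi>"
  by (induction \<phi>) auto

text \<open>Under a binder the free-index bound drops by one while \<open>upN\<close> or
  \<open>upS\<close> fixes index 0 and moves the rest up, so agreement below the bound passes to the
  body. This is what lets a renaming be chosen freely above the bound.\<close>

lemma subst_cong:
  assumes "\<And>i. i < nfree \<phi> \<Longrightarrow> \<sigma> i = \<sigma>' i" and "\<And>s i. i < sfree s \<phi> \<Longrightarrow> \<rho> s i = \<rho>' s i"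
  shows "subst \<sigma> \<rho> \<phi> = subst \<sigma>' \<rho>' \<phi>"
  using assms
proof (induction \<phi> arbitrary: \<sigma> \<rho> \<sigma>' \<rho>')
  case (Eq t u)
  then show ?case by (auto intro: tsubst_cong)
next
  case (Mem t s i)
  have "\<rho> s i = \<rho>' s i" using Mem(2)[of i s] by simp
  with Mem(1) show ?case by (auto intro: tsubst_cong)
next
  case (Imp \<phi> \<psi>)
  from Imp.IH(1)[of \<sigma> \<sigma>' \<rho> \<rho>'] Imp.IH(2)[of \<sigma> \<sigma>' \<rho> \<rho>'] Imp.prems show ?case by auto
next
  case (And \<phi> \<psi>)
  from And.IH(1)[of \<sigma> \<sigma>' \<rho> \<rho>'] And.IH(2)[of \<sigma> \<sigma>' \<rho> \<rho>'] And.prems show ?case by auto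
next
  case (Or \<phi> \<psi>)
  from Or.IH(1)[of \<sigma> \<sigma>' \<rho> \<rho>'] Or.IH(2)[of \<sigma> \<sigma>' \<rho> \<rho>'] Or.prems show ?case by auto
next
  case (AllN \<phi>)
  have "subst (upN \<sigma>) \<rho> \<phi> = subst (upN \<sigma>') \<rho>' \<phi>"
    by (rule AllN.IH) (use AllN.prems in \<open>auto simp: upN_def split: nat.split\<close>)
  then show ?case by simp
next
  case (ExN \<phi>)
  have "subst (upN \<sigma>) \<rho> \<phi> = subst (upN \<sigma>') \<rho>' \<phi>"
    by (rule ExN.IH) (use ExN.prems in \<open>auto simp: upN_def split: nat.split\<close>)
  then show ?case by simp
next
  case (AllS s \<phi>)
  have "subst \<sigma> (upS s \<rho>) \<phi> = subst \<sigma>' (upS s \<rho>') \<phi>"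
    by (rule AllS.IH) (use AllS.prems in \<open>force simp: upS_def split: nat.split\<close>)+
  then show ?case by simp
next
  case (ExS s \<phi>)
  have "subst \<sigma> (upS s \<rho>) \<phi> = subst \<sigma>' (upS s \<rho>') \<phi>"
    by (rule ExS.IH) (use ExS.prems in \<open>force simp: upS_def split: nat.split\<close>)+
  then show ?case by simp
qed simp

lemma finite_sorts: "finite (sorts \<phi>)"
  by (induction \<phi>) auto

lemma sfree_pos: "0 < sfree s \<phi> \<Longrightarrow> s \<in> sorts \<phi>"
  by (induction \<phi>) (auto simp: less_max_iff_disj split: if_splits)

lemma no_set_quant_subst [simp]: "no_set_quant (subst \<sigma> \<rho> \<phi>) = no_set_quant \<phi>"
  by (induction \<phi> arbitrary: \<sigma> \<rho>) auto

text \<open>The instantiation cancels the shift inside \<open>upN\<close>, leaving one simultaneous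
  substitution. In this form the numerical quantifier cases of the truth lemma in
  \<open>ex_model\<close> fall to the induction hypothesis.\<close>

lemma instN_upN: "instN t (subst (upN \<sigma>) \<rho> \<phi>) = subst (case_nat t \<sigma>) \<rho> \<phi>"
proof -
  have "tsubst (case_nat t Var) (upN \<sigma> i) = case_nat t \<sigma> i" for i
    by (simp add: upN_def tshift_def tsubst_tsubst split: nat.split)
  then show ?thesis by (simp add: instN_def subst_subst)
qed

text \<open>The right-hand renaming is \<open>push s k \<rho>\<close> written out, which is how the
  set quantifier cases in \<open>ex_model\<close> meet the semantics.\<close>

lemma instS_upS:
  "instS s k (subst \<sigma> (upS s \<rho>) \<phi>) = subst \<sigma> (\<lambda>s' i. if s' = s then case_nat k (\<rho> s) i else \<rho> s' i) \<phi>"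
  by (simp add: instS_def subst_subst upS_def if_distrib cong: if_cong)
    (rule arg_cong[where f = "\<lambda>\<rho>. subst \<sigma> \<rho> \<phi>"], auto split: nat.split intro!: ext)


section \<open>Admissible rules\<close>

lemma weaken: "derives T \<Gamma> \<phi> \<Longrightarrow> set \<Gamma> \<subseteq> set \<Delta> \<Longrightarrow> derives T \<Delta> \<phi>"
proof (induction arbitrary: \<Delta> rule: derives.induct)
  case (OrE \<Gamma> \<phi> \<psi> \<chi>)
  show ?case
    by (rule derives.OrE[OF OrE.IH(1)[OF OrE.prems]]; rule OrE.IH) (use OrE.prems in auto)
next
  case (AllNI \<Gamma> \<phi>)
  show ?case by (rule derives.AllNI, rule AllNI.IH) (use AllNI.prems in auto)
next
  case (ExNE \<Gamma> \<phi> \<psi>)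
  show ?case by (rule derives.ExNE[OF ExNE.IH(1)[OF ExNE.prems]], rule ExNE.IH) (use ExNE.prems in auto)
next
  case (AllSI s \<Gamma> \<phi>)
  show ?case by (rule derives.AllSI, rule AllSI.IH) (use AllSI.prems in auto)
next
  case (ExSE \<Gamma> s \<phi> \<psi>)
  show ?case by (rule derives.ExSE[OF ExSE.IH(1)[OF ExSE.prems]], rule ExSE.IH) (use ExSE.prems in auto)
next
  case (ImpI \<phi> \<Gamma> \<psi>)
  show ?case by (rule derives.ImpI, rule ImpI.IH) (use ImpI.prems in auto)
next
  case (Classical \<phi> \<Gamma>)
  show ?case by (rule derives.Classical, rule Classical.IH) (use Classical.prems in auto)
qed (blast intro: derives.intros)+

section \<open>Closure of derivability under substitution\<close>

text \<open>A theorem has no hypotheses, so its variable 0 can be generalised. The induction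
  hypothesis substitutes for the remaining variables of the quantified formula, and instantiating
  the quantifier supplies the value at 0.\<close>

lemma provable_substN: "T \<turnstile> \<phi> \<Longrightarrow> T \<turnstile> subst \<sigma> (\<lambda>_ i. i) \<phi>"
proof (induction "nfree \<phi>" arbitrary: \<phi> \<sigma>)
  case 0
  have "subst \<sigma> (\<lambda>_ i. i) \<phi> = subst Var (\<lambda>_ i. i) \<phi>"
    by (rule subst_cong) (use 0 in auto)
  with 0 show ?case by simp
next
  case (Suc n)
  have "T \<turnstile> AllN \<phi>"
    using Suc.prems by (auto simp: provable_def intro: derives.AllNI)
  then have "T \<turnstile> subst (\<lambda>i. \<sigma> (Suc i)) (\<lambda>_ i. i) (AllN \<phi>)"
    using Suc.hyps by (auto simp del: subst.simps)
  then have "T \<turnstile> instN (\<sigma> 0) (subst (upN (\<lambda>i. \<sigma> (Suc i))) (\<lambda>_ i. i) \<phi>)"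
    unfolding provable_def by (intro derives.AllNE) simp
  moreover have "case_nat (\<sigma> 0) (\<lambda>i. \<sigma> (Suc i)) = \<sigma>"
    by (auto split: nat.split intro!: ext)
  ultimately show ?case by (simp add: instN_upN)
qed

text \<open>The same generalise-and-instantiate argument. As several sorts may have free variables,
  the measure is the sum of the bounds; quantifying one variable of sort \<open>s\<close> lowers
  it.\<close>

lemma provable_substS: "T \<turnstile> \<phi> \<Longrightarrow> T \<turnstile> subst Var \<rho> \<phi>"
proof (induction "\<Sum>s\<in>sorts \<phi>. sfree s \<phi>" arbitrary: \<phi> \<rho> rule: less_induct)
  case less
  show ?case
  proof (cases "\<exists>s. 0 < sfree s \<phi>")
    case False
    have "subst Var \<rho> \<phi> = subst Var (\<lambda>_ i. i) \<phi>"
      by (rule subst_cong) (use False in auto)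
    with less.prems show ?thesis by simp
  next
    case True
    then obtain s where s: "0 < sfree s \<phi>" by auto
    define \<rho>' where "\<rho>' = (\<lambda>s' i. if s' = s then \<rho> s (Suc i) else \<rho> s' i)"
    \<comment> \<open>A sort with a positive bound already occurs in \<open>\<phi>\<close>, so the
      new quantifier adds no sort and both sums range over the same set.\<close>
    have "sorts (AllS s \<phi>) = sorts \<phi>" using sfree_pos[OF s] by auto
    then have "(\<Sum>s'\<in>sorts (AllS s \<phi>). sfree s' (AllS s \<phi>)) < (\<Sum>s'\<in>sorts \<phi>. sfree s' \<phi>)"
      by (simp only:, intro sum_strict_mono_ex1) (use s in \<open>auto simp: finite_sorts intro!: bexI[OF _ sfree_pos[OF s]]\<close>)
    moreover have "T \<turnstile> AllS s \<phi>"
      using less.prems by (auto simp: provable_def intro: derives.AllSI)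
    ultimately have "T \<turnstile> subst Var \<rho>' (AllS s \<phi>)"
      by (rule less.hyps)
    then have "T \<turnstile> instS s (\<rho> s 0) (subst Var (upS s \<rho>') \<phi>)"
      unfolding provable_def by (intro derives.AllSE) simp
    moreover have "(\<lambda>s' i. if s' = s then case_nat (\<rho> s 0) (\<rho>' s) i else \<rho>' s' i) = \<rho>"
      by (auto simp: \<rho>'_def split: nat.split intro!: ext)
    ultimately show ?thesis by (simp add: instS_upS)
  qed
qed

lemma provable_subst: "T \<turnstile> \<phi> \<Longrightarrow> T \<turnstile> subst \<sigma> \<rho> \<phi>"
  using provable_substN[OF provable_substS[of T \<phi> \<rho>], of \<sigma>] by (simp add: subst_subst)

text \<open>Moving the hypotheses into the formula transfers substitution from theorems to arbitrary
  derivations. The list is reversed because the head of \<open>\<Gamma>\<close> is discharged first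
  and becomes the innermost antecedent.\<close>

lemma derives_foldr_Imp: "derives T \<Gamma> \<phi> \<longleftrightarrow> T \<turnstile> foldr Imp (rev \<Gamma>) \<phi>"
proof (induction \<Gamma> arbitrary: \<phi>)
  case (Cons \<gamma> \<Gamma>)
  have "derives T (\<gamma> # \<Gamma>) \<phi> \<longleftrightarrow> derives T \<Gamma> (Imp \<gamma> \<phi>)"
    by (auto intro: derives.ImpI derives.ImpE[OF weaken derives.Hyp])
  with Cons show ?case by simp
qed (simp add: provable_def)

lemma subst_foldr_Imp:
  "subst \<sigma> \<rho> (foldr Imp \<Gamma> \<phi>) = foldr Imp (map (subst \<sigma> \<rho>) \<Gamma>) (subst \<sigma> \<rho> \<phi>)"
  by (induction \<Gamma>) auto

lemma derives_subst: "derives T \<Gamma> \<phi> \<Longrightarrow> derives T (map (subst \<sigma> \<rho>) \<Gamma>) (subst \<sigma> \<rho> \<phi>)"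
  using provable_subst[of T "foldr Imp (rev \<Gamma>) \<phi>" \<sigma> \<rho>]
  by (simp add: derives_foldr_Imp subst_foldr_Imp rev_map)

section \<open>Fresh variables as witnesses, and duality of the quantifiers\<close>

text \<open>The renaming \<open>\<sigma>\<close> sends the fresh index \<open>k\<close> to 0 and
  every other index one up. It acts as \<open>liftN\<close> on \<open>\<Gamma>\<close>, whose free
  indices lie below \<open>k\<close>, and turns the instance back into \<open>\<psi>\<close>. The
  renamed derivation is the premise of \<open>ExNE\<close>.\<close>

lemma fresh_witnessN:
  assumes d: "derives T (instN (Var k) \<psi> # \<Gamma>) Bot" and k: "\<And>\<gamma>. \<gamma> \<in> set (ExN \<psi> # \<Gamma>) \<Longrightarrow> nfree \<gamma> \<le> k"
  shows "derives T (ExN \<psi> # \<Gamma>) Bot"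
proof -
  define \<sigma> where "\<sigma> i = (if i = k then Var 0 else Var (Suc i))" for i
  have "subst \<sigma> (\<lambda>_ i. i) \<gamma> = liftN \<gamma>" if "\<gamma> \<in> set \<Gamma>" for \<gamma>
    unfolding liftN_def by (rule subst_cong) (use k[of \<gamma>] that in \<open>auto simp: \<sigma>_def\<close>)
  then have *: "map (subst \<sigma> (\<lambda>_ i. i)) \<Gamma> = map liftN \<Gamma>" by simp
  have "subst \<sigma> (\<lambda>_ i. i) (instN (Var k) \<psi>) = subst Var (\<lambda>_ i. i) \<psi>"
    unfolding instN_def subst_subst
    by (rule subst_cong) (use k[of "ExN \<psi>"] in \<open>auto simp: \<sigma>_def split: nat.split\<close>)
  with derives_subst[OF d, of \<sigma> "\<lambda>_ i. i"] * have "derives T (\<psi> # map liftN \<Gamma>) (liftN Bot)"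
    by (simp add: liftN_def)
  then have "derives T (\<psi> # map liftN (ExN \<psi> # \<Gamma>)) (liftN Bot)"
    by (rule weaken) auto
  moreover have "derives T (ExN \<psi> # \<Gamma>) (ExN \<psi>)"
    by (rule derives.Hyp) simp
  ultimately show ?thesis by (blast intro: derives.ExNE)
qed

text \<open>The same renaming, performed in the index space of sort \<open>s\<close> only.\<close>

lemma fresh_witnessS:
  assumes d: "derives T (instS s k \<psi> # \<Gamma>) Bot"
    and k: "\<And>\<gamma>. \<gamma> \<in> set (ExS s \<psi> # \<Gamma>) \<Longrightarrow> sfree s \<gamma> \<le> k"
  shows "derives T (ExS s \<psi> # \<Gamma>) Bot"
proof -
  define \<rho> where "\<rho> s' i = (if s' = s then if i = k then 0 else Suc i else i)" for s' i
  have "subst Var \<rho> \<gamma> = liftS s \<gamma>" if "\<gamma> \<in> set \<Gamma>" for \<gamma>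
    unfolding liftS_def by (rule subst_cong) (use k[of \<gamma>] that in \<open>auto simp: \<rho>_def shS_def\<close>)
  then have *: "map (subst Var \<rho>) \<Gamma> = map (liftS s) \<Gamma>" by simp
  have "subst Var \<rho> (instS s k \<psi>) = subst Var (\<lambda>_ i. i) \<psi>"
    unfolding instS_def subst_subst
    by (rule subst_cong) (use k[of "ExS s \<psi>"] in \<open>auto simp: \<rho>_def split: nat.split\<close>)
  with derives_subst[OF d, of Var \<rho>] * have "derives T (\<psi> # map (liftS s) \<Gamma>) (liftS s Bot)"
    by (simp add: liftS_def)
  then have "derives T (\<psi> # map (liftS s) (ExS s \<psi> # \<Gamma>)) (liftS s Bot)"
    by (rule weaken) auto
  moreover have "derives T (ExS s \<psi> # \<Gamma>) (ExS s \<psi>)"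
    by (rule derives.Hyp) simp
  ultimately show ?thesis by (blast intro: derives.ExSE)
qed

lemma instN_0_upN [simp]: "instN (Var 0) (subst (upN (\<lambda>i. Var (Suc i))) (\<lambda>_ i. i) \<phi>) = \<phi>"
proof -
  have "case_nat (Var 0) (\<lambda>i. Var (Suc i)) = Var" by (auto split: nat.split intro!: ext)
  then show ?thesis by (simp add: instN_upN)
qed

lemma instS_0_upS [simp]: "instS s 0 (subst Var (upS s (shS s)) \<phi>) = \<phi>"
proof -
  have "(\<lambda>s' i. if s' = s then case_nat 0 (shS s s) i else shS s s' i) = (\<lambda>_ i. i)"
    by (auto simp: shS_def split: nat.split intro!: ext)
  then show ?thesis by (simp add: instS_upS)
qed

text \<open>Because of this duality it is enough to add witnesses for existential formulas: a
  universal formula outside a Henkin set produces a counterexample through its negation.\<close>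

lemma Neg_AllN: "derives T \<Gamma> (Neg (AllN \<psi>)) \<Longrightarrow> derives T \<Gamma> (ExN (Neg \<psi>))"
proof (rule derives.Classical)
  let ?N = "Neg (ExN (Neg \<psi>))"
  let ?\<Delta> = "Neg \<psi> # map liftN (?N # \<Gamma>)"
  assume "derives T \<Gamma> (Neg (AllN \<psi>))"
  then have neg: "derives T (?N # \<Gamma>) (Imp (AllN \<psi>) Bot)"
    unfolding Neg_def by (rule weaken) auto
  \<comment> \<open>Lifting \<open>?N\<close> puts a shifted copy of \<open>Neg \<psi>\<close> below
    its quantifier; by \<open>instN_0_upN\<close> the instance of that copy at \<open>Var 0\<close>
    is \<open>Neg \<psi>\<close> again.\<close>
  have "derives T ?\<Delta> (ExN (subst (upN (\<lambda>i. Var (Suc i))) (\<lambda>_ i. i) (Neg \<psi>)))"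
    by (rule derives.ExNI[where t = "Var 0"], rule derives.Hyp) simp
  moreover have "derives T ?\<Delta> (liftN ?N)"
    by (rule derives.Hyp) simp
  ultimately have "derives T ?\<Delta> Bot"
    by (simp add: liftN_def Neg_def) (blast intro: derives.ImpE)
  then have "derives T (?N # \<Gamma>) (AllN \<psi>)"
    by (rule derives.AllNI[OF derives.Classical])
  with neg show "derives T (?N # \<Gamma>) Bot" by (rule derives.ImpE)
qed

lemma Neg_AllS: "derives T \<Gamma> (Neg (AllS s \<psi>)) \<Longrightarrow> derives T \<Gamma> (ExS s (Neg \<psi>))"
proof (rule derives.Classical)
  let ?N = "Neg (ExS s (Neg \<psi>))"
  let ?\<Delta> = "Neg \<psi> # map (liftS s) (?N # \<Gamma>)"
  assume "derives T \<Gamma> (Neg (AllS s \<psi>))"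
  then have neg: "derives T (?N # \<Gamma>) (Imp (AllS s \<psi>) Bot)"
    unfolding Neg_def by (rule weaken) auto
  have "derives T ?\<Delta> (ExS s (subst Var (upS s (shS s)) (Neg \<psi>)))"
    by (rule derives.ExSI[where i = 0], rule derives.Hyp) simp
  moreover have "derives T ?\<Delta> (liftS s ?N)"
    by (rule derives.Hyp) simp
  ultimately have "derives T ?\<Delta> Bot"
    by (simp add: liftS_def Neg_def) (blast intro: derives.ImpE)
  then have "derives T (?N # \<Gamma>) (AllS s \<psi>)"
    by (rule derives.AllSI[OF derives.Classical])
  with neg show "derives T (?N # \<Gamma>) Bot" by (rule derives.ImpE)
qed

section \<open>Equality as a congruence\<close>

text \<open>\<open>EqSubst\<close> with the formula \<open>\<phi>\<close> as an explicit parameter, since unification cannot read it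
  off from its instances.\<close>

lemma Eq_replace:
  assumes "derives T \<Gamma> (Eq t u)" and "derives T \<Gamma> \<psi>" and "\<psi> = instN t \<phi>" and "\<chi> = instN u \<phi>"
  shows "derives T \<Gamma> \<chi>"
  using assms derives.EqSubst by blast

lemma instN_tshift: "tsubst (case_nat t Var) (tshift u) = u"
  by (simp add: tshift_def tsubst_tsubst)

text \<open>In the auxiliary formula index 0 marks the occurrence to be replaced, and
  \<open>tshift\<close> keeps the other terms out of reach of the instantiation. The following
  lemmas use the same device.\<close>

lemma Eq_sym: "derives T \<Gamma> (Eq t u) \<Longrightarrow> derives T \<Gamma> (Eq u t)"
  by (rule Eq_replace[OF _ derives.EqRefl[of _ _ t], where \<phi> = "Eq (Var 0) (tshift t)"])
    (simp_all add: instN_def instN_tshift)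

lemma Eq_trans: "derives T \<Gamma> (Eq t u) \<Longrightarrow> derives T \<Gamma> (Eq u v) \<Longrightarrow> derives T \<Gamma> (Eq t v)"
  by (rule Eq_replace[where t = u and \<phi> = "Eq (tshift t) (Var 0)"])
    (simp_all add: instN_def instN_tshift)

lemma Eq_Add:
  assumes "derives T \<Gamma> (Eq t t')" and "derives T \<Gamma> (Eq u u')"
  shows "derives T \<Gamma> (Eq (Add t u) (Add t' u'))"
proof -
  have "derives T \<Gamma> (Eq (Add t u) (Add t' u))"
    by (rule Eq_replace[OF assms(1) derives.EqRefl, where \<phi> = "Eq (tshift (Add t u)) (Add (Var 0) (tshift u))"])
      (simp_all add: instN_def instN_tshift)
  then show ?thesis
    by (rule Eq_replace[OF assms(2), where \<phi> = "Eq (tshift (Add t u)) (Add (tshift t') (Var 0))"])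
      (simp_all add: instN_def instN_tshift)
qed

lemma Eq_Mul:
  assumes "derives T \<Gamma> (Eq t t')" and "derives T \<Gamma> (Eq u u')"
  shows "derives T \<Gamma> (Eq (Mul t u) (Mul t' u'))"
proof -
  have "derives T \<Gamma> (Eq (Mul t u) (Mul t' u))"
    by (rule Eq_replace[OF assms(1) derives.EqRefl, where \<phi> = "Eq (tshift (Mul t u)) (Mul (Var 0) (tshift u))"])
      (simp_all add: instN_def instN_tshift)
  then show ?thesis
    by (rule Eq_replace[OF assms(2), where \<phi> = "Eq (tshift (Mul t u)) (Mul (tshift t') (Var 0))"])
      (simp_all add: instN_def instN_tshift)
qed

lemma Eq_Mem: "derives T \<Gamma> (Eq t u) \<Longrightarrow> derives T \<Gamma> (Mem t s i) \<Longrightarrow> derives T \<Gamma> (Mem u s i)"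
  by (erule Eq_replace[where \<phi> = "Mem (Var 0) s i"]) (simp_all add: instN_def)


section \<open>Structures\<close>

text \<open>Quantifiers range over whole types, with one type \<open>'d\<close> for the sets of
  every sort. Elements of \<open>'d\<close> are only names: different ones may have the same
  members, since set equality is not primitive in the language.\<close>

datatype ('n, 'd, 's) struct = Struct
  (zero_of: 'n) (one_of: 'n) (plus_of: "'n \<Rightarrow> 'n \<Rightarrow> 'n") (times_of: "'n \<Rightarrow> 'n \<Rightarrow> 'n")
  (elem_of: "'n \<Rightarrow> 's \<Rightarrow> 'd \<Rightarrow> bool")

primrec teval :: "('n, 'd, 's) struct \<Rightarrow> (nat \<Rightarrow> 'n) \<Rightarrow> tm \<Rightarrow> 'n" where
  "teval M e (Var i) = e i"
| "teval M e Zero = zero_of M"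
| "teval M e One = one_of M"
| "teval M e (Add t u) = plus_of M (teval M e t) (teval M e u)"
| "teval M e (Mul t u) = times_of M (teval M e t) (teval M e u)"

definition push :: "'s \<Rightarrow> 'd \<Rightarrow> ('s \<Rightarrow> nat \<Rightarrow> 'd) \<Rightarrow> 's \<Rightarrow> nat \<Rightarrow> 'd" where
  "push s x r s' i = (if s' = s then case_nat x (r s) i else r s' i)"

primrec sat :: "('n, 'd, 's) struct \<Rightarrow> (nat \<Rightarrow> 'n) \<Rightarrow> ('s \<Rightarrow> nat \<Rightarrow> 'd) \<Rightarrow> 's fm \<Rightarrow> bool" where
  "sat M e r (Eq t u) = (teval M e t = teval M e u)"
| "sat M e r (Mem t s i) = elem_of M (teval M e t) s (r s i)"
| "sat M e r Bot = False"
| "sat M e r (Imp \<phi> \<psi>) = (sat M e r \<phi> \<longrightarrow> sat M e r \<psi>)"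
| "sat M e r (And \<phi> \<psi>) = (sat M e r \<phi> \<and> sat M e r \<psi>)"
| "sat M e r (Or \<phi> \<psi>) = (sat M e r \<phi> \<or> sat M e r \<psi>)"
| "sat M e r (AllN \<phi>) = (\<forall>a. sat M (case_nat a e) r \<phi>)"
| "sat M e r (ExN \<phi>) = (\<exists>a. sat M (case_nat a e) r \<phi>)"
| "sat M e r (AllS s \<phi>) = (\<forall>x. sat M e (push s x r) \<phi>)"
| "sat M e r (ExS s \<phi>) = (\<exists>x. sat M e (push s x r) \<phi>)"

definition models :: "('n, 'd, 's) struct \<Rightarrow> 's fm set \<Rightarrow> bool" where
  "models M T \<longleftrightarrow> (\<forall>\<phi>\<in>T. \<forall>e r. sat M e r \<phi>)"

lemma modelsD: "models M T \<Longrightarrow> \<phi> \<in> T \<Longrightarrow> sat M e r \<phi>"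
  by (simp add: models_def)

lemma models_Un: "models M (T \<union> U) \<longleftrightarrow> models M T \<and> models M U"
  by (auto simp: models_def)

lemma sat_Neg [simp]: "sat M e r (Neg \<phi>) \<longleftrightarrow> \<not> sat M e r \<phi>"
  by (simp add: Neg_def)

lemma sat_Iff [simp]: "sat M e r (Iff \<phi> \<psi>) \<longleftrightarrow> (sat M e r \<phi> \<longleftrightarrow> sat M e r \<psi>)"
  by (auto simp: Iff_def)

lemma push_same [simp]: "push s x r s i = case_nat x (r s) i"
  by (simp add: push_def)

lemma push_other [simp]: "s' \<noteq> s \<Longrightarrow> push s x r s' i = r s' i"
  by (simp add: push_def)

lemma teval_tsubst: "teval M e (tsubst \<sigma> t) = teval M (\<lambda>i. teval M e (\<sigma> i)) t"
  by (induction t) auto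

lemma teval_tshift [simp]: "teval M (case_nat a e) (tshift t) = teval M e t"
  by (simp add: tshift_def teval_tsubst)

lemma teval_upN: "(\<lambda>i. teval M (case_nat a e) (upN \<sigma> i)) = case_nat a (\<lambda>i. teval M e (\<sigma> i))"
  by (rule ext) (simp add: upN_def split: nat.split)

lemma push_upS: "(\<lambda>s' i. push s x r s' (upS s \<rho> s' i)) = push s x (\<lambda>s i. r s (\<rho> s i))"
  by (intro ext) (auto simp: push_def upS_def split: nat.split)

lemma sat_subst: "sat M e r (subst \<sigma> \<rho> \<phi>) = sat M (\<lambda>i. teval M e (\<sigma> i)) (\<lambda>s i. r s (\<rho> s i)) \<phi>"
  by (induction \<phi> arbitrary: e r \<sigma> \<rho>) (simp_all add: teval_tsubst teval_upN push_upS)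

lemma sat_liftN [simp]: "sat M (case_nat a e) r (liftN \<phi>) = sat M e r \<phi>"
  by (simp add: liftN_def sat_subst)

lemma push_shS [simp]: "(\<lambda>s' i. push s x r s' (shS s s' i)) = r"
  by (intro ext) (simp add: push_def shS_def)

lemma sat_liftS [simp]: "sat M e (push s x r) (liftS s \<phi>) = sat M e r \<phi>"
  by (simp add: liftS_def sat_subst)

lemma sat_instN [simp]: "sat M e r (instN t \<phi>) = sat M (case_nat (teval M e t) e) r \<phi>"
proof -
  have "(\<lambda>i. teval M e (case i of 0 \<Rightarrow> t | Suc j \<Rightarrow> Var j)) = case_nat (teval M e t) e"
    by (rule ext) (simp split: nat.split)
  then show ?thesis by (simp add: instN_def sat_subst)
qed

lemma sat_instS [simp]: "sat M e r (instS s k \<phi>) = sat M e (push s (r s k) r) \<phi>"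
proof -
  have "(\<lambda>s' i. r s' (if s' = s then case i of 0 \<Rightarrow> k | Suc j \<Rightarrow> j else i)) = push s (r s k) r"
    by (intro ext) (simp add: push_def split: nat.split)
  then show ?thesis by (simp add: instS_def sat_subst)
qed

text \<open>Axioms must hold under all assignments, since the quantifier rules change the assignment
  while only the hypotheses are lifted. Lifted hypotheses do not see the new value, so it suffices
  that they hold at the given assignment.\<close>

theorem soundness:
  assumes "derives T \<Gamma> \<phi>" and T: "models M T" and "\<And>\<gamma>. \<gamma> \<in> set \<Gamma> \<Longrightarrow> sat M e r \<gamma>"
  shows "sat M e r \<phi>"
  using assms(1,3)
proof (induction arbitrary: e r rule: derives.induct)
  case (Ax \<phi> \<Gamma>)
  then show ?case using T by (simp add: modelsD)
next
  case (OrE \<Gamma> \<phi> \<psi> \<chi>)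
  then show ?case by (metis sat.simps(6) set_ConsD)
next
  case (Classical \<phi> \<Gamma>)
  then show ?case by (metis sat.simps(3) sat_Neg set_ConsD)
next
  case (AllNI \<Gamma> \<phi>)
  have "sat M (case_nat a e) r \<phi>" for a
    by (rule AllNI.IH) (use AllNI.prems in auto)
  then show ?case by simp
next
  case (ExNE \<Gamma> \<phi> \<psi>)
  then obtain a where "sat M (case_nat a e) r \<phi>" by force
  then have "sat M (case_nat a e) r (liftN \<psi>)" by (intro ExNE.IH) (use ExNE.prems in auto)
  then show ?case by simp
next
  case (AllSI s \<Gamma> \<phi>)
  have "sat M e (push s x r) \<phi>" for x
    by (rule AllSI.IH) (use AllSI.prems in auto)
  then show ?case by simp
next
  case (ExSE \<Gamma> s \<phi> \<psi>)
  then obtain x where "sat M e (push s x r) \<phi>" by force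
  then have "sat M e (push s x r) (liftS s \<psi>)" by (intro ExSE.IH) (use ExSE.prems in auto)
  then show ?case by simp
qed fastforce+


section \<open>Completeness\<close>

definition consistent :: "'s fm set \<Rightarrow> 's fm list \<Rightarrow> bool" where
  "consistent T \<Gamma> \<longleftrightarrow> \<not> derives T \<Gamma> Bot"

text \<open>Variables play the role of Henkin constants: only finitely many formulas are present, so
  the maximum of their free-index bounds is a fresh index.\<close>

primrec witness :: "'s fm list \<Rightarrow> 's fm \<Rightarrow> 's fm list" where
  "witness \<Gamma> (Eq t u) = []"
| "witness \<Gamma> (Mem t s i) = []"
| "witness \<Gamma> Bot = []"
| "witness \<Gamma> (Imp \<phi> \<psi>) = []"
| "witness \<Gamma> (And \<phi> \<psi>) = []"
| "witness \<Gamma> (Or \<phi> \<psi>) = []"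
| "witness \<Gamma> (AllN \<phi>) = []"
| "witness \<Gamma> (ExN \<phi>) = [instN (Var (Max (nfree ` set (ExN \<phi> # \<Gamma>)))) \<phi>]"
| "witness \<Gamma> (AllS s \<phi>) = []"
| "witness \<Gamma> (ExS s \<phi>) = [instS s (Max (sfree s ` set (ExS s \<phi> # \<Gamma>))) \<phi>]"

lemma consistent_witness:
  assumes "consistent T (\<chi> # \<Gamma>)"
  shows "consistent T (witness \<Gamma> \<chi> @ \<chi> # \<Gamma>)"
proof (cases \<chi>)
  case (ExN \<phi>)
  let ?k = "Max (nfree ` set (ExN \<phi> # \<Gamma>))"
  have k: "nfree \<gamma> \<le> ?k" if "\<gamma> \<in> set (ExN \<phi> # \<Gamma>)" for \<gamma>
    using that by (intro Max_ge) auto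
  have "\<not> derives T (instN (Var ?k) \<phi> # ExN \<phi> # \<Gamma>) Bot"
  proof
    assume "derives T (instN (Var ?k) \<phi> # ExN \<phi> # \<Gamma>) Bot"
    \<comment> \<open>The existential formula is itself among the hypotheses here, so two copies
      result, which weakening merges.\<close>
    then have "derives T (ExN \<phi> # ExN \<phi> # \<Gamma>) Bot"
      by (rule fresh_witnessN) (use k in auto)
    then have "derives T (ExN \<phi> # \<Gamma>) Bot" by (rule weaken) simp
    with assms ExN show False by (simp add: consistent_def)
  qed
  with ExN show ?thesis by (simp add: consistent_def)
next
  case (ExS s \<phi>)
  let ?k = "Max (sfree s ` set (ExS s \<phi> # \<Gamma>))"
  have k: "sfree s \<gamma> \<le> ?k" if "\<gamma> \<in> set (ExS s \<phi> # \<Gamma>)" for \<gamma>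
    using that by (intro Max_ge) auto
  have "\<not> derives T (instS s ?k \<phi> # ExS s \<phi> # \<Gamma>) Bot"
  proof
    assume "derives T (instS s ?k \<phi> # ExS s \<phi> # \<Gamma>) Bot"
    then have "derives T (ExS s \<phi> # ExS s \<phi> # \<Gamma>) Bot"
      by (rule fresh_witnessS) (use k in auto)
    then have "derives T (ExS s \<phi> # \<Gamma>) Bot" by (rule weaken) simp
    with assms ExS show False by (simp add: consistent_def)
  qed
  with ExS show ?thesis by (simp add: consistent_def)
qed (use assms in simp_all)

text \<open>Stage \<open>n\<close> decides the \<open>n\<close>-th formula and adds a witness for it
  at once. Stages stay finite lists, which keeps fresh indices available.\<close>

primrec extension :: "'s::countable fm set \<Rightarrow> 's fm list \<Rightarrow> nat \<Rightarrow> 's fm list" where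
  "extension T \<Gamma> 0 = \<Gamma>"
| "extension T \<Gamma> (Suc n) =
    (let \<chi> = from_nat n; \<Delta> = extension T \<Gamma> n
     in if consistent T (\<chi> # \<Delta>) then witness \<Delta> \<chi> @ \<chi> # \<Delta> else \<Delta>)"

lemma extension_mono: "m \<le> n \<Longrightarrow> set (extension T \<Gamma> m) \<subseteq> set (extension T \<Gamma> n)"
  by (rule lift_Suc_mono_le[of "\<lambda>n. set (extension T \<Gamma> n)"]) (auto simp: Let_def)

lemma consistent_extension: "consistent T \<Gamma> \<Longrightarrow> consistent T (extension T \<Gamma> n)"
  by (induction n) (auto simp: Let_def intro: consistent_witness)

definition henkin_set :: "'s::countable fm set \<Rightarrow> 's fm list \<Rightarrow> 's fm set" where
  "henkin_set T \<Gamma> = (\<Union>n. set (extension T \<Gamma> n))"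

locale henkin =
  fixes T :: "'s::countable fm set" and \<Gamma> :: "'s fm list"
  assumes con: "consistent T \<Gamma>"
begin

abbreviation H where "H \<equiv> henkin_set T \<Gamma>"

lemma finite_subset_extension: "set \<Delta> \<subseteq> H \<Longrightarrow> \<exists>n. set \<Delta> \<subseteq> set (extension T \<Gamma> n)"
proof (induction \<Delta>)
  case (Cons \<chi> \<Delta>)
  then obtain n m where "set \<Delta> \<subseteq> set (extension T \<Gamma> n)" "\<chi> \<in> set (extension T \<Gamma> m)"
    by (auto simp: henkin_set_def)
  then have "set (\<chi> # \<Delta>) \<subseteq> set (extension T \<Gamma> (max n m))"
    using extension_mono[of n "max n m" T \<Gamma>] extension_mono[of m "max n m" T \<Gamma>] by auto
  then show ?case by blast
qed simp

lemma H_consistent: "set \<Delta> \<subseteq> H \<Longrightarrow> consistent T \<Delta>"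
proof -
  assume "set \<Delta> \<subseteq> H"
  then obtain n where "set \<Delta> \<subseteq> set (extension T \<Gamma> n)"
    using finite_subset_extension by blast
  then show ?thesis
    using consistent_extension[OF con, of n] weaken[of T \<Delta> Bot] unfolding consistent_def by blast
qed

lemma extension_subset_H: "set (extension T \<Gamma> n) \<subseteq> H"
  by (auto simp: henkin_set_def)

text \<open>At the stage treating \<open>\<chi>\<close>, either it is added or the formulas already
  present refute it.\<close>

lemma H_maximal: "\<chi> \<in> H \<or> (\<exists>\<Delta>. set \<Delta> \<subseteq> H \<and> derives T (\<chi> # \<Delta>) Bot)"
proof -
  obtain n where n: "\<chi> = from_nat n" by (metis from_nat_to_nat)
  show ?thesis
  proof (cases "consistent T (\<chi> # extension T \<Gamma> n)")
    case True
    then have "\<chi> \<in> set (extension T \<Gamma> (Suc n))" using n by (simp add: Let_def)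
    then show ?thesis using extension_subset_H by blast
  next
    case False
    then have "derives T (\<chi> # extension T \<Gamma> n) Bot" by (simp add: consistent_def)
    then show ?thesis using extension_subset_H by blast
  qed
qed

text \<open>If \<open>\<chi>\<close> were missing, finitely many elements of \<open>H\<close> would
  refute it; joined with the derivation of \<open>\<chi>\<close> they would form an inconsistent
  finite part of \<open>H\<close>.\<close>

lemma H_closed: "set \<Delta> \<subseteq> H \<Longrightarrow> derives T \<Delta> \<chi> \<Longrightarrow> \<chi> \<in> H"
proof (rule ccontr)
  assume \<Delta>: "set \<Delta> \<subseteq> H" "derives T \<Delta> \<chi>" and "\<chi> \<notin> H"
  then obtain \<Delta>' where \<Delta>': "set \<Delta>' \<subseteq> H" "derives T (\<chi> # \<Delta>') Bot"
    using H_maximal by blast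
  have "derives T (\<Delta> @ \<Delta>') (Imp \<chi> Bot)"
    by (rule weaken[OF derives.ImpI[OF \<Delta>'(2)]]) simp
  moreover have "derives T (\<Delta> @ \<Delta>') \<chi>"
    by (rule weaken[OF \<Delta>(2)]) simp
  ultimately have "derives T (\<Delta> @ \<Delta>') Bot" by (rule derives.ImpE)
  moreover have "consistent T (\<Delta> @ \<Delta>')"
    by (rule H_consistent) (use \<Delta>(1) \<Delta>'(1) in auto)
  ultimately show False by (simp add: consistent_def)
qed

lemma H_provable: "T \<turnstile> \<chi> \<Longrightarrow> \<chi> \<in> H"
  by (rule H_closed[of "[]"]) (simp_all add: provable_def)

lemma H_rule1: "\<phi> \<in> H \<Longrightarrow> derives T [\<phi>] \<chi> \<Longrightarrow> \<chi> \<in> H"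
  by (rule H_closed[of "[\<phi>]"]) simp_all

lemma H_rule2: "\<phi> \<in> H \<Longrightarrow> \<psi> \<in> H \<Longrightarrow> derives T [\<phi>, \<psi>] \<chi> \<Longrightarrow> \<chi> \<in> H"
  by (rule H_closed[of "[\<phi>, \<psi>]"]) simp_all

section \<open>Truth conditions for membership in the Henkin set\<close>

lemma H_Bot: "Bot \<notin> H"
  using H_consistent[of "[Bot]"] derives.Hyp[of Bot "[Bot]" T] by (auto simp: consistent_def)

lemma H_Imp: "Imp \<phi> \<psi> \<in> H \<longleftrightarrow> (\<phi> \<in> H \<longrightarrow> \<psi> \<in> H)"
proof
  have d: "derives T [Imp \<phi> \<psi>, \<phi>] \<psi>"
    by (rule derives.ImpE[of _ _ \<phi>]; rule derives.Hyp; simp)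
  assume "Imp \<phi> \<psi> \<in> H"
  then show "\<phi> \<in> H \<longrightarrow> \<psi> \<in> H" using H_rule2[OF _ _ d] by blast
next
  assume imp: "\<phi> \<in> H \<longrightarrow> \<psi> \<in> H"
  show "Imp \<phi> \<psi> \<in> H"
  proof (cases "\<phi> \<in> H")
    case True
    with imp have "\<psi> \<in> H" by simp
    then show ?thesis by (rule H_rule1) (rule derives.ImpI, rule derives.Hyp, simp)
  next
    case False
    then obtain \<Delta> where \<Delta>: "set \<Delta> \<subseteq> H" "derives T (\<phi> # \<Delta>) Bot"
      using H_maximal by blast
    \<comment> \<open>Ex falso: \<open>Bot\<close> is already derivable, so \<open>Classical\<close>
      yields \<open>\<psi>\<close>.\<close>
    have "derives T (\<phi> # \<Delta>) \<psi>"
      by (rule derives.Classical) (rule weaken[OF \<Delta>(2)], auto)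
    with \<Delta>(1) show ?thesis by (rule H_closed[OF _ derives.ImpI])
  qed
qed

lemma H_Neg: "Neg \<phi> \<in> H \<longleftrightarrow> \<phi> \<notin> H"
  by (simp add: Neg_def H_Imp H_Bot)

lemma H_And: "And \<phi> \<psi> \<in> H \<longleftrightarrow> \<phi> \<in> H \<and> \<psi> \<in> H"
proof -
  have 1: "derives T [And \<phi> \<psi>] \<phi>"
    by (rule derives.AndE1[of _ _ \<phi> \<psi>], rule derives.Hyp, simp)
  have 2: "derives T [And \<phi> \<psi>] \<psi>"
    by (rule derives.AndE2[of _ _ \<phi> \<psi>], rule derives.Hyp, simp)
  have 3: "derives T [\<phi>, \<psi>] (And \<phi> \<psi>)"
    by (rule derives.AndI; rule derives.Hyp; simp)
  show ?thesis using H_rule1[OF _ 1] H_rule1[OF _ 2] H_rule2[OF _ _ 3] by blast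
qed

lemma H_Or: "Or \<phi> \<psi> \<in> H \<longleftrightarrow> \<phi> \<in> H \<or> \<psi> \<in> H"
proof
  assume or: "Or \<phi> \<psi> \<in> H"
  show "\<phi> \<in> H \<or> \<psi> \<in> H"
  proof (rule ccontr)
    assume "\<not> (\<phi> \<in> H \<or> \<psi> \<in> H)"
    then have neg: "set [Or \<phi> \<psi>, Neg \<phi>, Neg \<psi>] \<subseteq> H"
      using or by (simp add: H_Neg)
    have "derives T [Or \<phi> \<psi>, Neg \<phi>, Neg \<psi>] Bot"
    proof (rule derives.OrE[of _ _ \<phi> \<psi>])
      show "derives T [Or \<phi> \<psi>, Neg \<phi>, Neg \<psi>] (Or \<phi> \<psi>)"
        by (rule derives.Hyp) simp
      show "derives T [\<phi>, Or \<phi> \<psi>, Neg \<phi>, Neg \<psi>] Bot"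
        by (rule derives.ImpE[of _ _ \<phi>]; rule derives.Hyp; simp add: Neg_def)
      show "derives T [\<psi>, Or \<phi> \<psi>, Neg \<phi>, Neg \<psi>] Bot"
        by (rule derives.ImpE[of _ _ \<psi>]; rule derives.Hyp; simp add: Neg_def)
    qed
    with neg show False using H_closed H_Bot by blast
  qed
next
  have 1: "derives T [\<phi>] (Or \<phi> \<psi>)" and 2: "derives T [\<psi>] (Or \<phi> \<psi>)"
    by (rule derives.OrI1, rule derives.Hyp, simp) (rule derives.OrI2, rule derives.Hyp, simp)
  assume "\<phi> \<in> H \<or> \<psi> \<in> H"
  then show "Or \<phi> \<psi> \<in> H" using H_rule1[OF _ 1] H_rule1[OF _ 2] by blast
qed

text \<open>An element of \<open>H\<close> is consistent with the stage at which it is treated, so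
  it was added there together with its witness; \<open>\<Delta>\<close> is that stage.\<close>

lemma H_witness:
  assumes "\<chi> \<in> H"
  shows "\<exists>\<Delta>. set (witness \<Delta> \<chi>) \<subseteq> H"
proof -
  obtain n where n: "\<chi> = from_nat n" by (metis from_nat_to_nat)
  have "consistent T (\<chi> # extension T \<Gamma> n)"
    by (rule H_consistent) (use extension_subset_H[of n] assms in simp)
  with n have "set (witness (extension T \<Gamma> n) \<chi>) \<subseteq> set (extension T \<Gamma> (Suc n))"
    by (auto simp: Let_def)
  with extension_subset_H show ?thesis by blast
qed

lemma H_ExN: "ExN \<phi> \<in> H \<longleftrightarrow> (\<exists>t. instN t \<phi> \<in> H)"
proof
  show "ExN \<phi> \<in> H \<Longrightarrow> \<exists>t. instN t \<phi> \<in> H"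
    using H_witness[of "ExN \<phi>"] by auto
next
  assume "\<exists>t. instN t \<phi> \<in> H"
  then obtain t where "instN t \<phi> \<in> H" ..
  then show "ExN \<phi> \<in> H"
    by (rule H_rule1) (rule derives.ExNI, rule derives.Hyp, simp)
qed

lemma H_ExS: "ExS s \<phi> \<in> H \<longleftrightarrow> (\<exists>k. instS s k \<phi> \<in> H)"
proof
  show "ExS s \<phi> \<in> H \<Longrightarrow> \<exists>k. instS s k \<phi> \<in> H"
    using H_witness[of "ExS s \<phi>"] by auto
next
  assume "\<exists>k. instS s k \<phi> \<in> H"
  then obtain k where "instS s k \<phi> \<in> H" ..
  then show "ExS s \<phi> \<in> H"
    by (rule H_rule1) (rule derives.ExSI, rule derives.Hyp, simp)
qed

lemma H_AllN: "AllN \<phi> \<in> H \<longleftrightarrow> (\<forall>t. instN t \<phi> \<in> H)"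
proof
  assume "AllN \<phi> \<in> H"
  then have "instN t \<phi> \<in> H" for t
    by (rule H_rule1) (rule derives.AllNE, rule derives.Hyp, simp)
  then show "\<forall>t. instN t \<phi> \<in> H" by blast
next
  assume all: "\<forall>t. instN t \<phi> \<in> H"
  show "AllN \<phi> \<in> H"
  proof (rule ccontr)
    assume "AllN \<phi> \<notin> H"
    then have "Neg (AllN \<phi>) \<in> H" by (simp add: H_Neg)
    then have "ExN (Neg \<phi>) \<in> H"
      by (rule H_rule1) (rule Neg_AllN, rule derives.Hyp, simp)
    then obtain t where "Neg (instN t \<phi>) \<in> H" by (auto simp: H_ExN instN_def Neg_def)
    with all show False by (simp add: H_Neg)
  qed
qed

lemma H_AllS: "AllS s \<phi> \<in> H \<longleftrightarrow> (\<forall>k. instS s k \<phi> \<in> H)"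
proof
  assume "AllS s \<phi> \<in> H"
  then have "instS s k \<phi> \<in> H" for k
    by (rule H_rule1) (rule derives.AllSE, rule derives.Hyp, simp)
  then show "\<forall>k. instS s k \<phi> \<in> H" by blast
next
  assume all: "\<forall>k. instS s k \<phi> \<in> H"
  show "AllS s \<phi> \<in> H"
  proof (rule ccontr)
    assume "AllS s \<phi> \<notin> H"
    then have "Neg (AllS s \<phi>) \<in> H" by (simp add: H_Neg)
    then have "ExS s (Neg \<phi>) \<in> H"
      by (rule H_rule1) (rule Neg_AllS, rule derives.Hyp, simp)
    then obtain k where "Neg (instS s k \<phi>) \<in> H" by (auto simp: H_ExS instS_def Neg_def)
    with all show False by (simp add: H_Neg)
  qed
qed

section \<open>The term model modulo equality in the Henkin set\<close>

abbreviation equiv_tm :: "tm \<Rightarrow> tm \<Rightarrow> bool" (infix "\<approx>" 50) where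
  "t \<approx> u \<equiv> Eq t u \<in> H"

lemma equiv_refl: "t \<approx> t"
  by (rule H_provable) (simp add: provable_def derives.EqRefl)

lemma equiv_sym: "t \<approx> u \<Longrightarrow> u \<approx> t"
  by (erule H_rule1, rule Eq_sym, rule derives.Hyp) simp

lemma equiv_trans: "t \<approx> u \<Longrightarrow> u \<approx> v \<Longrightarrow> t \<approx> v"
  by (erule (1) H_rule2, rule Eq_trans[where u = u]; rule derives.Hyp; simp)

lemma equiv_Add: "t \<approx> t' \<Longrightarrow> u \<approx> u' \<Longrightarrow> Add t u \<approx> Add t' u'"
  by (erule (1) H_rule2, rule Eq_Add; rule derives.Hyp; simp)

lemma equiv_Mul: "t \<approx> t' \<Longrightarrow> u \<approx> u' \<Longrightarrow> Mul t u \<approx> Mul t' u'"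
  by (erule (1) H_rule2, rule Eq_Mul; rule derives.Hyp; simp)

lemma equiv_Mem: "t \<approx> u \<Longrightarrow> Mem t s i \<in> H \<Longrightarrow> Mem u s i \<in> H"
  by (erule (1) H_rule2, rule Eq_Mem[where t = t]; rule derives.Hyp; simp)

text \<open>The Peano axioms make the numerals pairwise inequivalent, so the countable term model has
  infinitely many numbers and can be carried over to the full type \<^typ>\<open>nat\<close>. This avoids
  structures with a carrier set.\<close>

lemma numerals_inj:
  assumes "peano \<subseteq> T"
  shows "inj (\<lambda>n. {t. ((\<lambda>t. Add t One) ^^ n) Zero \<approx> t})"
proof -
  define num where "num n = ((\<lambda>t. Add t One) ^^ n) Zero" for n
  \<comment> \<open>The axioms carry free variables; substitution turns them into statements about
    arbitrary terms.\<close>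
  have subst: "subst \<sigma> (\<lambda>_ i. i) \<chi> \<in> H" if "\<chi> \<in> peano" for \<sigma> \<chi>
    by (rule H_provable, rule provable_subst)
      (use that assms in \<open>auto simp: provable_def intro: derives.Ax\<close>)
  have ne: "\<not> Add t One \<approx> Zero" for t
    using subst[of "Neg (Eq (Add (Var 0) One) Zero)" "\<lambda>_. t"]
    by (simp add: peano_def Neg_def H_Imp H_Bot)
  have inj: "t \<approx> u" if "Add t One \<approx> Add u One" for t u
    using that subst[of "Imp (Eq (Add (Var 0) One) (Add (Var 1) One)) (Eq (Var 0) (Var 1))" "case_nat t (\<lambda>_. u)"]
    by (simp add: peano_def H_Imp)
  have "m = n" if "num m \<approx> num n" for m n
    using that
  proof (induction m arbitrary: n)
    case 0
    then show ?case using ne equiv_sym by (cases n) (auto simp: num_def)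
  next
    case (Suc m)
    then show ?case using ne inj by (cases n) (auto simp: num_def)
  qed
  then show ?thesis
    unfolding num_def[symmetric] using equiv_refl by (intro injI) blast
qed

lemma ex_classification:
  assumes "peano \<subseteq> T"
  obtains cl :: "tm \<Rightarrow> nat" where "surj cl" and "\<And>t u. cl t = cl u \<longleftrightarrow> t \<approx> u"
proof -
  define Q where "Q = range (\<lambda>t. {u. t \<approx> u})"
  \<comment> \<open>The numerals alone give infinitely many classes, and terms are countable, so
    \<open>to_nat_on\<close> numbers \<open>Q\<close> by all of \<open>nat\<close>.\<close>
  have "range (\<lambda>n. {t. ((\<lambda>t. Add t One) ^^ n) Zero \<approx> t}) \<subseteq> Q"
    by (auto simp: Q_def)
  moreover have "infinite (range (\<lambda>n. {t. ((\<lambda>t. Add t One) ^^ n) Zero \<approx> t}))"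
    using numerals_inj[OF assms] by (rule range_inj_infinite)
  ultimately have "infinite Q" by (rule infinite_super)
  then have bij: "bij_betw (to_nat_on Q) Q UNIV"
    by (intro to_nat_on_infinite) (simp_all add: Q_def)
  show ?thesis
  proof
    show "surj (\<lambda>t. to_nat_on Q {u. t \<approx> u})"
      using bij_betw_imp_surj_on[OF bij] by (simp add: Q_def image_image)
    show "to_nat_on Q {v. t \<approx> v} = to_nat_on Q {v. u \<approx> v} \<longleftrightarrow> t \<approx> u" for t u
    proof -
      have "to_nat_on Q {v. t \<approx> v} = to_nat_on Q {v. u \<approx> v} \<longleftrightarrow> {v. t \<approx> v} = {v. u \<approx> v}"
        by (rule inj_on_eq_iff[OF bij_betw_imp_inj_on[OF bij]]) (auto simp: Q_def)
      also have "\<dots> \<longleftrightarrow> t \<approx> u"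
        using equiv_refl equiv_sym equiv_trans by blast
      finally show ?thesis .
    qed
  qed
qed

text \<open>Numbers are codes of term classes, sets of each sort are indices of set variables, and
  \<open>H\<close> decides membership. The number \<open>cl t\<close> is named by the term
  \<open>t\<close>, so substitutions take the place of assignments in the truth lemma.\<close>

lemma ex_model:
  assumes "peano \<subseteq> T"
  shows "\<exists>(M :: (nat, nat, 's) struct) e r. models M T \<and> (\<forall>\<gamma>\<in>set \<Gamma>. sat M e r \<gamma>)"
proof -
  obtain cl :: "tm \<Rightarrow> nat" where surj: "surj cl" and cl: "\<And>t u. cl t = cl u \<longleftrightarrow> t \<approx> u"
    using ex_classification[OF assms] by blast
  define rep where "rep = inv cl"
  have cl_rep: "cl (rep n) = n" for n
    by (simp add: rep_def surj_f_inv_f[OF surj])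
  define M :: "(nat, nat, 's) struct" where
    "M = Struct (cl Zero) (cl One) (\<lambda>a b. cl (Add (rep a) (rep b))) (\<lambda>a b. cl (Mul (rep a) (rep b)))
      (\<lambda>a s i. Mem (rep a) s i \<in> H)"
  have rep_cl: "rep (cl t) \<approx> t" for t
    using cl_rep[of "cl t"] cl by blast
  have teval: "teval M (\<lambda>i. cl (\<sigma> i)) t = cl (tsubst \<sigma> t)" for \<sigma> t
    by (induction t) (auto simp: M_def cl intro: equiv_Add equiv_Mul rep_cl)
  have truth: "sat M (\<lambda>i. cl (\<sigma> i)) \<rho> \<chi> \<longleftrightarrow> subst \<sigma> \<rho> \<chi> \<in> H" for \<sigma> \<rho> \<chi>
  proof (induction \<chi> arbitrary: \<sigma> \<rho>)
    case (Eq t u)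
    then show ?case by (simp add: teval cl)
  next
    case (Mem t s i)
    have "elem_of M (cl (tsubst \<sigma> t)) s (\<rho> s i) \<longleftrightarrow> Mem (tsubst \<sigma> t) s (\<rho> s i) \<in> H"
      by (simp add: M_def) (meson equiv_Mem equiv_sym rep_cl)
    then show ?case by (simp add: teval)
  next
    case (AllN \<chi>)
    have push: "case_nat (cl t) (\<lambda>i. cl (\<sigma> i)) = (\<lambda>i. cl (case_nat t \<sigma> i))" for t
      by (auto split: nat.split)
    \<comment> \<open>Since \<open>cl\<close> is onto, quantifying over numbers is the same as
      quantifying over terms.\<close>
    have "sat M (\<lambda>i. cl (\<sigma> i)) \<rho> (AllN \<chi>) \<longleftrightarrow> (\<forall>t. sat M (case_nat (cl t) (\<lambda>i. cl (\<sigma> i))) \<rho> \<chi>)"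
      using cl_rep by simp metis
    then show ?case by (simp add: push AllN.IH H_AllN instN_upN)
  next
    case (ExN \<chi>)
    have push: "case_nat (cl t) (\<lambda>i. cl (\<sigma> i)) = (\<lambda>i. cl (case_nat t \<sigma> i))" for t
      by (auto split: nat.split)
    have "sat M (\<lambda>i. cl (\<sigma> i)) \<rho> (ExN \<chi>) \<longleftrightarrow> (\<exists>t. sat M (case_nat (cl t) (\<lambda>i. cl (\<sigma> i))) \<rho> \<chi>)"
      using cl_rep by simp metis
    then show ?case by (simp add: push ExN.IH H_ExN instN_upN)
  next
    case (AllS s \<chi>)
    then show ?case by (simp add: H_AllS instS_upS push_def[abs_def])
  next
    case (ExS s \<chi>)
    then show ?case by (simp add: H_ExS instS_upS push_def[abs_def])
  qed (simp_all add: H_Bot H_Imp H_And H_Or)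
  have "sat M e r \<chi>" if "\<chi> \<in> T" for \<chi> e r
  proof -
    \<comment> \<open>An arbitrary assignment is named by representative terms; the matching
      substitution instance of an axiom is a theorem and so lies in \<open>H\<close>.\<close>
    have "subst (\<lambda>i. rep (e i)) r \<chi> \<in> H"
      by (rule H_provable, rule provable_subst) (use that in \<open>auto simp: provable_def intro: derives.Ax\<close>)
    with truth[of "\<lambda>i. rep (e i)" r \<chi>] show ?thesis by (simp add: cl_rep)
  qed
  moreover have "sat M (\<lambda>i. cl (Var i)) (\<lambda>_ i. i) \<gamma>" if "\<gamma> \<in> set \<Gamma>" for \<gamma>
  proof -
    have "\<gamma> \<in> set (extension T \<Gamma> 0)" using that by simp
    then have "\<gamma> \<in> H" unfolding henkin_set_def by blast
    then show ?thesis using truth[of Var "\<lambda>_ i. i" \<gamma>] by simp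
  qed
  ultimately show ?thesis unfolding models_def by blast
qed

end

text \<open>If \<open>\<phi>\<close> is unprovable, \<open>Neg \<phi>\<close> is consistent with
  \<open>T\<close> and has a term model. Countable sorts allow the enumeration of formulas, and the
  Peano axioms make the numbers infinite, so that models on \<open>nat\<close> suffice.\<close>

theorem completeness:
  fixes T :: "'s::countable fm set"
  assumes "peano \<subseteq> T"
    and "\<And>(M :: (nat, nat, 's) struct) e r. models M T \<Longrightarrow> sat M e r \<phi>"
  shows "T \<turnstile> \<phi>"
proof (rule ccontr)
  assume "\<not> T \<turnstile> \<phi>"
  then interpret henkin T "[Neg \<phi>]"
    by unfold_locales (auto simp: consistent_def provable_def intro: derives.Classical)
  show False
    using ex_model[OF assms(1)] assms(2) by auto
qed


section \<open>Arithmetic in models\<close>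

text \<open>The Cantor equation \<open>z = (a + b)(a + b + 1)/2 + a\<close>, doubled to avoid
  division, as in \<open>pair_mem\<close>.\<close>

definition is_pair :: "('n, 'd, 's) struct \<Rightarrow> 'n \<Rightarrow> 'n \<Rightarrow> 'n \<Rightarrow> bool" where
  "is_pair M z a b \<longleftrightarrow> plus_of M z z =
     plus_of M (times_of M (plus_of M a b) (plus_of M (plus_of M a b) (one_of M))) (plus_of M a a)"

locale pa_model =
  fixes M :: "('n, 'd, 's) struct"
  assumes peano: "models M peano" and induction: "models M (range induction_ax)"
begin

abbreviation zero ("\<zero>") where "\<zero> \<equiv> zero_of M"
abbreviation one ("\<one>") where "\<one> \<equiv> one_of M"
abbreviation plus (infixl "\<oplus>" 65) where "a \<oplus> b \<equiv> plus_of M a b"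
abbreviation times (infixl "\<otimes>" 70) where "a \<otimes> b \<equiv> times_of M a b"

text \<open>A model may be nonstandard, so induction is available only for properties given by
  formulas. The inductive proofs below therefore name their formula: index 0 is the induction
  variable and the parameters sit in the assignment.\<close>

lemma induct:
  assumes "sat M (case_nat \<zero> e) r \<phi>"
    and "\<And>a. sat M (case_nat a e) r \<phi> \<Longrightarrow> sat M (case_nat (a \<oplus> \<one>) e) r \<phi>"
  shows "sat M (case_nat a e) r \<phi>"
proof -
  have "(\<lambda>i. teval M (case_nat a e) (case i of 0 \<Rightarrow> Add (Var 0) One | Suc j \<Rightarrow> Var (Suc j)))
      = case_nat (a \<oplus> \<one>) e" for a
    by (rule ext) (simp split: nat.split)
  then show ?thesis
    using modelsD[OF induction, of "induction_ax \<phi>" e r] assms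
    by (simp add: induction_ax_def sat_subst)
qed

section \<open>Arithmetical laws by formal induction\<close>

lemma suc_neq_zero: "a \<oplus> \<one> \<noteq> \<zero>"
  using modelsD[OF peano, of "Neg (Eq (Add (Var 0) One) Zero)" "\<lambda>_. a"] by (simp add: peano_def)

lemma suc_inject: "a \<oplus> \<one> = b \<oplus> \<one> \<Longrightarrow> a = b"
  using modelsD[OF peano, of "Imp (Eq (Add (Var 0) One) (Add (Var 1) One)) (Eq (Var 0) (Var 1))"
      "case_nat a (\<lambda>_. b)"] by (simp add: peano_def)

lemma add_zero: "a \<oplus> \<zero> = a"
  using modelsD[OF peano, of "Eq (Add (Var 0) Zero) (Var 0)" "\<lambda>_. a"] by (simp add: peano_def)

lemma add_suc: "a \<oplus> (b \<oplus> \<one>) = a \<oplus> b \<oplus> \<one>"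
  using modelsD[OF peano, of "Eq (Add (Var 0) (Add (Var 1) One)) (Add (Add (Var 0) (Var 1)) One)"
      "case_nat a (\<lambda>_. b)"] by (simp add: peano_def)

lemma mult_zero: "a \<otimes> \<zero> = \<zero>"
  using modelsD[OF peano, of "Eq (Mul (Var 0) Zero) Zero" "\<lambda>_. a"] by (simp add: peano_def)

lemma mult_suc: "a \<otimes> (b \<oplus> \<one>) = a \<otimes> b \<oplus> a"
  using modelsD[OF peano, of "Eq (Mul (Var 0) (Add (Var 1) One)) (Add (Mul (Var 0) (Var 1)) (Var 0))"
      "case_nat a (\<lambda>_. b)"] by (simp add: peano_def)

lemma zero_add: "\<zero> \<oplus> a = a"
  using induct[of "\<lambda>_. \<zero>" undefined "Eq (Add Zero (Var 0)) (Var 0)" a]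
  by (simp add: add_zero add_suc)

lemma add_assoc: "a \<oplus> b \<oplus> c = a \<oplus> (b \<oplus> c)"
  using induct[of "case_nat a (\<lambda>_. b)" undefined
      "Eq (Add (Add (Var 1) (Var 2)) (Var 0)) (Add (Var 1) (Add (Var 2) (Var 0)))" c]
  by (simp add: add_zero add_suc numeral_2_eq_2)

lemma suc_add: "a \<oplus> \<one> \<oplus> b = a \<oplus> b \<oplus> \<one>"
  using induct[of "\<lambda>_. a" undefined
      "Eq (Add (Add (Var 1) One) (Var 0)) (Add (Add (Var 1) (Var 0)) One)" b]
  by (simp add: add_zero add_suc)

lemma add_commute: "a \<oplus> b = b \<oplus> a"
  using induct[of "\<lambda>_. a" undefined "Eq (Add (Var 1) (Var 0)) (Add (Var 0) (Var 1))" b]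
  by (simp add: add_zero zero_add add_suc suc_add)

lemma add_left_commute: "a \<oplus> (b \<oplus> c) = b \<oplus> (a \<oplus> c)"
  by (metis add_assoc add_commute)

lemmas add_ac = add_assoc add_commute add_left_commute

lemma zero_mult: "\<zero> \<otimes> a = \<zero>"
  using induct[of "\<lambda>_. \<zero>" undefined "Eq (Mul Zero (Var 0)) Zero" a]
  by (simp add: add_zero mult_zero mult_suc)

lemma suc_mult: "(a \<oplus> \<one>) \<otimes> b = a \<otimes> b \<oplus> b"
  using induct[of "\<lambda>_. a" undefined
      "Eq (Mul (Add (Var 1) One) (Var 0)) (Add (Mul (Var 1) (Var 0)) (Var 0))" b]
  by (simp add: add_zero mult_zero mult_suc add_ac)

lemma mult_commute: "a \<otimes> b = b \<otimes> a"
  using induct[of "\<lambda>_. a" undefined "Eq (Mul (Var 1) (Var 0)) (Mul (Var 0) (Var 1))" b]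
  by (simp add: zero_mult mult_zero mult_suc suc_mult)

lemma distrib_left: "a \<otimes> (b \<oplus> c) = a \<otimes> b \<oplus> a \<otimes> c"
  using induct[of "case_nat a (\<lambda>_. b)" undefined
      "Eq (Mul (Var 1) (Add (Var 2) (Var 0))) (Add (Mul (Var 1) (Var 2)) (Mul (Var 1) (Var 0)))" c]
  by (simp add: add_zero mult_zero add_assoc[symmetric] mult_suc numeral_2_eq_2)

lemma distrib_right: "(a \<oplus> b) \<otimes> c = a \<otimes> c \<oplus> b \<otimes> c"
  using distrib_left[of c a b] by (simp add: mult_commute)

lemma mult_one: "a \<otimes> \<one> = a" and one_mult: "\<one> \<otimes> a = a"
  using mult_suc[of a \<zero>] suc_mult[of \<zero> a] by (simp_all add: zero_add mult_zero zero_mult)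

lemma add_right_cancel: "a \<oplus> c = b \<oplus> c \<longleftrightarrow> a = b"
  using induct[of "case_nat a (\<lambda>_. b)" undefined
      "Imp (Eq (Add (Var 1) (Var 0)) (Add (Var 2) (Var 0))) (Eq (Var 1) (Var 2))" c]
  by (auto simp: add_zero add_assoc[symmetric] numeral_2_eq_2 dest: suc_inject)

lemma add_left_cancel: "c \<oplus> a = c \<oplus> b \<longleftrightarrow> a = b"
  by (metis add_commute add_right_cancel)

lemma add_suc_neq: "a \<oplus> (b \<oplus> \<one>) \<noteq> a"
  using add_left_cancel[of a "b \<oplus> \<one>" \<zero>] suc_neq_zero[of b] by (simp add: add_zero)

lemma zero_or_suc: "a = \<zero> \<or> (\<exists>b. a = b \<oplus> \<one>)"
  using induct[of "\<lambda>_. \<zero>" undefined "Or (Eq (Var 0) Zero) (ExN (Eq (Var 1) (Add (Var 0) One)))" a]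
  by auto

text \<open>Differences replace an order relation. In the induction on \<open>a\<close>, if
  \<open>b\<close> is \<open>a\<close> plus \<open>c\<close>, then \<open>c\<close> is either zero,
  and the successor of \<open>a\<close> exceeds \<open>b\<close> by one, or a successor, and the
  difference shrinks by one.\<close>

lemma linear: "\<exists>c. a = b \<oplus> c \<or> b = a \<oplus> c"
proof -
  have "\<exists>d. a \<oplus> \<one> = b \<oplus> d \<or> b = a \<oplus> \<one> \<oplus> d" if "a = b \<oplus> c \<or> b = a \<oplus> c" for a c
    using that
  proof
    assume "a = b \<oplus> c"
    then show ?thesis by (metis add_assoc)
  next
    assume "b = a \<oplus> c"
    then show ?thesis using zero_or_suc[of c] by (metis add_zero add_assoc add_commute)
  qed
  then show ?thesis
    using induct[of "\<lambda>_. b" undefined "ExN (Or (Eq (Var 1) (Add (Var 2) (Var 0)))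
        (Eq (Var 2) (Add (Var 1) (Var 0))))" a]
    by (auto simp: zero_add numeral_2_eq_2)
qed

text \<open>By comparability one number is the other plus some \<open>c\<close>. A nonzero
  \<open>c\<close> would make the doubles differ by a successor.\<close>

lemma double_inject: "a \<oplus> a = b \<oplus> b \<Longrightarrow> a = b"
proof -
  have *: "b = b \<oplus> c" if "b \<oplus> c \<oplus> (b \<oplus> c) = b \<oplus> b" for b c
  proof (cases "c = \<zero>")
    case False
    then obtain d where "c = d \<oplus> \<one>" using zero_or_suc by blast
    then have "b \<oplus> c \<oplus> (b \<oplus> c) = b \<oplus> b \<oplus> (d \<oplus> d \<oplus> \<one> \<oplus> \<one>)" by (simp add: add_ac)
    with that add_suc_neq[of "b \<oplus> b" "d \<oplus> d \<oplus> \<one>"] show ?thesis by simp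
  qed (simp add: add_zero)
  assume "a \<oplus> a = b \<oplus> b"
  with linear[of a b] *[of a] *[of b] show ?thesis by metis
qed

section \<open>Existence and uniqueness of Cantor codes\<close>

text \<open>Induction on \<open>c\<close> shows that \<open>c(c + 1)\<close> is a double: passing to
  the next \<open>c\<close> adds \<open>c + 1\<close> to the half. Adding \<open>a\<close> to the
  half for \<open>c = a + b\<close> gives the code.\<close>

lemma ex_pair: "\<exists>z. is_pair M z a b"
proof -
  have step: "z \<oplus> z = c \<otimes> (c \<oplus> \<one>) \<Longrightarrow>
      (z \<oplus> c \<oplus> \<one>) \<oplus> (z \<oplus> c \<oplus> \<one>) = (c \<oplus> \<one>) \<otimes> (c \<oplus> \<one> \<oplus> \<one>)" for z c
  proof -
    assume z: "z \<oplus> z = c \<otimes> (c \<oplus> \<one>)"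
    have "(z \<oplus> c \<oplus> \<one>) \<oplus> (z \<oplus> c \<oplus> \<one>) = z \<oplus> z \<oplus> (c \<oplus> \<one> \<oplus> (c \<oplus> \<one>))"
      by (simp add: add_ac)
    also have "\<dots> = (c \<oplus> \<one>) \<otimes> (c \<oplus> \<one> \<oplus> \<one>)"
      unfolding z by (simp add: distrib_left distrib_right mult_one one_mult add_ac)
    finally show ?thesis .
  qed
  have "\<exists>z. z \<oplus> z = c \<otimes> (c \<oplus> \<one>)" for c
    using induct[of "\<lambda>_. \<zero>" undefined
        "ExN (Eq (Add (Var 0) (Var 0)) (Mul (Var 1) (Add (Var 1) One)))" c]
    by (force simp: zero_mult dest: step intro: zero_add)
  then obtain z where "z \<oplus> z = (a \<oplus> b) \<otimes> (a \<oplus> b \<oplus> \<one>)" by blast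
  moreover have "z \<oplus> a \<oplus> (z \<oplus> a) = z \<oplus> z \<oplus> (a \<oplus> a)" by (simp add: add_ac)
  ultimately have "is_pair M (z \<oplus> a) a b" by (simp add: is_pair_def)
  then show ?thesis ..
qed

text \<open>With \<open>s = a + b\<close>, the number of \<open>(a, b)\<close> lies in the block from \<open>s(s + 1)/2\<close> to
  \<open>s(s + 1)/2 + s\<close>; blocks with different \<open>s\<close> are disjoint.\<close>

lemma is_pair_sum_le:
  assumes "is_pair M z a b" and "is_pair M z a' b'" and sum: "a' \<oplus> b' = a \<oplus> b \<oplus> c"
  shows "a' = a \<and> b' = b"
proof (cases "c = \<zero>")
  case True
  have "a \<oplus> a = a' \<oplus> a'"
    using assms by (simp add: is_pair_def True add_zero add_left_cancel)
  then have "a = a'" by (rule double_inject)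
  with sum True show ?thesis by (simp add: add_zero add_left_cancel)
next
  case False
  then obtain d where d: "c = d \<oplus> \<one>" using zero_or_suc by blast
  define s where "s = a \<oplus> b"
  have "s \<otimes> (s \<oplus> \<one>) \<oplus> (a \<oplus> a) = (s \<oplus> c) \<otimes> (s \<oplus> c \<oplus> \<one>) \<oplus> (a' \<oplus> a')"
    using assms by (simp add: is_pair_def s_def)
  \<comment> \<open>As the sums differ by the successor of \<open>d\<close>, expanding the larger
    product leaves \<open>s + s\<close>, two ones and a remainder beyond the smaller
    product.\<close>
  also have "\<dots> = s \<otimes> (s \<oplus> \<one>) \<oplus> (s \<oplus> s \<oplus>
      (s \<otimes> d \<oplus> d \<otimes> (s \<oplus> d \<oplus> \<one> \<oplus> \<one>) \<oplus> d \<oplus> (a' \<oplus> a') \<oplus> \<one> \<oplus> \<one>))"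
    unfolding d by (simp add: distrib_left distrib_right mult_one one_mult add_ac)
  \<comment> \<open>Splitting \<open>s + s\<close> into \<open>a + a\<close> and
    \<open>b + b\<close> exhibits the right side as the left side plus a successor, which is
    impossible.\<close>
  also have "\<dots> = s \<otimes> (s \<oplus> \<one>) \<oplus> (a \<oplus> a \<oplus> (b \<oplus> b \<oplus>
      (s \<otimes> d \<oplus> d \<otimes> (s \<oplus> d \<oplus> \<one> \<oplus> \<one>) \<oplus> d \<oplus> (a' \<oplus> a') \<oplus> \<one>) \<oplus> \<one>))"
  proof -
    have "s \<oplus> s \<oplus> (x \<oplus> \<one>) = a \<oplus> a \<oplus> (b \<oplus> b \<oplus> x \<oplus> \<one>)" for x
      by (simp add: s_def add_ac)
    then show ?thesis by simp
  qed
  finally show ?thesis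
    unfolding add_left_cancel using add_suc_neq by metis
qed

lemma is_pair_inject:
  assumes "is_pair M z a b" and "is_pair M z a' b'"
  shows "a' = a \<and> b' = b"
  using linear[of "a \<oplus> b" "a' \<oplus> b'"] is_pair_sum_le assms by metis

end


section \<open>Choice from \<open>\<Delta>\<^sup>1\<^sub>1\<close>-comprehension\<close>

lemma sat_Ex1S:
  "sat M e r (Ex1S s \<phi>) \<longleftrightarrow>
    (\<exists>x. sat M e (push s x r) \<phi> \<and>
      (\<forall>x'. sat M e (push s x' r) \<phi> \<longrightarrow> (\<forall>a. elem_of M a s x' \<longleftrightarrow> elem_of M a s x)))"
  by (simp add: Ex1S_def set_eq_def sat_subst push_upS)

lemma sat_pair_mem:
  "sat M e r (pair_mem t u s i) \<longleftrightarrow>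
    (\<exists>z. is_pair M z (teval M e t) (teval M e u) \<and> elem_of M z s (r s i))"
  by (simp add: pair_mem_def Let_def is_pair_def)

lemma sat_choice_ax:
  "sat M e r (choice_ax s s' \<phi>) \<longleftrightarrow>
    ((\<forall>a. sat M (case_nat a e) r (Ex1S s \<phi>)) \<longrightarrow>
     (\<exists>y. \<forall>a. \<exists>x. sat M (case_nat a e) (push s x r) \<phi> \<and>
        (\<forall>b. elem_of M b s x \<longleftrightarrow> (\<exists>z. is_pair M z a b \<and> elem_of M z s' y))))"
proof -
  have "push s x (push s' y r) s' (if s = s' then 1 else 0) = y" for x y
    by auto
  then show ?thesis
    by (simp only: choice_ax_def sat.simps sat_Iff sat_pair_mem sat_subst push_upS push_shS push_same)
      simp
qed

lemma sat_comprehension_ax: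
  "sat M e r (comprehension_ax s \<phi>) \<longleftrightarrow>
    (\<exists>x. \<forall>a. elem_of M a s x \<longleftrightarrow> sat M (case_nat a e) r \<phi>)"
  by (simp add: comprehension_ax_def)

lemma sat_delta11_ax:
  "sat M e r (delta11_ax s \<phi> \<psi>) \<longleftrightarrow>
    ((\<forall>a. (\<forall>x. sat M (case_nat a e) (push s x r) \<phi>) \<longleftrightarrow> (\<exists>x. sat M (case_nat a e) (push s x r) \<psi>)) \<longrightarrow>
     (\<exists>x. \<forall>a. elem_of M a s x \<longleftrightarrow> (\<exists>x. sat M (case_nat a e) (push s x r) \<psi>)))"
  by (simp add: delta11_ax_def)

text \<open>Turns a condition on two numbers into one on their code, since comprehension yields sets
  of single numbers. Inside \<open>\<phi>\<close> the second component has index 0, the first index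
  1 and the code index 2.\<close>

definition pair_fm :: "'s fm \<Rightarrow> 's fm" where
  "pair_fm \<phi> = ExN (ExN (And (Eq (Add (Var 2) (Var 2))
     (Add (Mul (Add (Var 1) (Var 0)) (Add (Add (Var 1) (Var 0)) One)) (Add (Var 1) (Var 1)))) \<phi>))"

lemma sat_pair_fm:
  "sat M (case_nat p e) r (pair_fm \<phi>) \<longleftrightarrow>
    (\<exists>a b. is_pair M p a b \<and> sat M (case_nat b (case_nat a (case_nat p e))) r \<phi>)"
  by (simp add: pair_fm_def is_pair_def numeral_2_eq_2)

text \<open>Places a formula below the two quantifiers of \<open>pair_fm\<close>: its distinguished
  number becomes the first component, and its parameters move past both components and the
  code.\<close>

definition past_pair :: "'s fm \<Rightarrow> 's fm" where
  "past_pair = subst (case_nat (Var (Suc 0)) (\<lambda>j. Var (j + 3))) (\<lambda>_ i. i)"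

lemma sat_past_pair:
  "sat M (case_nat b (case_nat a (case_nat p e))) r (past_pair \<phi>) = sat M (case_nat a e) r \<phi>"
proof -
  have "(\<lambda>i. teval M (case_nat b (case_nat a (case_nat p e))) (case_nat (Var (Suc 0)) (\<lambda>j. Var (j + 3)) i))
      = case_nat a e"
    by (rule ext) (simp add: eval_nat_numeral split: nat.split)
  then show ?thesis by (simp add: past_pair_def sat_subst)
qed

text \<open>The set \<open>y\<close> of all numbers \<open>(n, m)\<close> with \<open>m \<in> x\<close> for the unique \<open>x\<close> such that \<open>\<phi>(n, x)\<close>
  is defined by \<open>\<exists>x (\<phi>(n, x) \<and> m \<in> x)\<close> and, by uniqueness, also by \<open>\<forall>x (\<phi>(n, x) \<longrightarrow> m \<in> x)\<close>.
  Asking for the components \<open>n, m\<close> existentially in both forms makes it irrelevant whether every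
  number is a pair.\<close>

lemma (in pa_model) delta11_imp_choice:
  assumes delta11: "\<And>\<phi> \<psi> e r. no_set_quant \<phi> \<Longrightarrow> no_set_quant \<psi> \<Longrightarrow> sat M e r (delta11_ax s \<phi> \<psi>)"
    and "no_set_quant \<phi>"
  shows "sat M e r (choice_ax s s \<phi>)"
  unfolding sat_choice_ax sat_Ex1S
proof
  let ?sat = "\<lambda>a x. sat M (case_nat a e) (push s x r) \<phi>"
  let ?\<phi> = "pair_fm (Imp (past_pair \<phi>) (Mem (Var 0) s 0))"
  let ?\<psi> = "pair_fm (And (past_pair \<phi>) (Mem (Var 0) s 0))"
  assume *: "\<forall>a. \<exists>x. ?sat a x \<and>
      (\<forall>x'. ?sat a x' \<longrightarrow> (\<forall>b. elem_of M b s x' \<longleftrightarrow> elem_of M b s x))"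
  \<comment> \<open>\<open>f\<close> is chosen outside the model and need not be definable.
    Uniqueness is up to having the same members, so it fixes only the members of
    \<open>f a\<close>.\<close>
  then obtain f where f: "\<And>a. ?sat a (f a)"
    and uniq: "\<And>a x b. ?sat a x \<Longrightarrow> elem_of M b s x \<longleftrightarrow> elem_of M b s (f a)"
    by metis
  have \<phi>: "(\<forall>x. sat M (case_nat p e) (push s x r) ?\<phi>) \<longleftrightarrow> (\<exists>a b. is_pair M p a b \<and> elem_of M b s (f a))" for p
    unfolding sat_pair_fm sat.simps sat_past_pair
  proof
    assume all: "\<forall>x. \<exists>a b. is_pair M p a b \<and> (?sat a x \<longrightarrow>
      elem_of M (teval M (case_nat b (case_nat a (case_nat p e))) (Var 0)) s (push s x r s 0))"
    \<comment> \<open>In \<open>all\<close> the components may depend on \<open>x\<close>. They are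
      read off first; then \<open>x\<close> is taken to be \<open>f a\<close>, and injectivity of
      the coding identifies the components found there with \<open>a\<close> and
      \<open>b\<close>.\<close>
    then obtain a b where "is_pair M p a b" by blast
    then show "\<exists>a b. is_pair M p a b \<and> elem_of M b s (f a)"
      using all[rule_format, of "f a"] f is_pair_inject by fastforce
  qed (use uniq in auto)
  have \<psi>: "(\<exists>x. sat M (case_nat p e) (push s x r) ?\<psi>) \<longleftrightarrow> (\<exists>a b. is_pair M p a b \<and> elem_of M b s (f a))" for p
    unfolding sat_pair_fm sat.simps sat_past_pair using f uniq by simp metis
  have "no_set_quant ?\<phi>" "no_set_quant ?\<psi>"
    using assms(2) by (simp_all add: pair_fm_def past_pair_def)
  from delta11[OF this, of e r] obtain y where
    y: "\<And>p. elem_of M p s y \<longleftrightarrow> (\<exists>a b. is_pair M p a b \<and> elem_of M b s (f a))"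
    unfolding sat_delta11_ax \<phi> \<psi> by blast
  \<comment> \<open>Existence of codes gives one direction, their injectivity the other.\<close>
  have "elem_of M b s (f a) \<longleftrightarrow> (\<exists>z. is_pair M z a b \<and> elem_of M z s y)" for a b
    using y ex_pair[of a b] is_pair_inject by metis
  with f show "\<exists>y. \<forall>a. \<exists>x. ?sat a x \<and> (\<forall>b. elem_of M b s x \<longleftrightarrow> (\<exists>z. is_pair M z a b \<and> elem_of M z s y))"
    by blast
qed

lemma Ar_AC_unique_subset_Delta11_C:
  assumes "Ar \<union> AC_unique \<turnstile> \<phi>"
  shows "Ar \<union> Delta11_C \<turnstile> \<phi>"
proof (rule completeness)
  show "peano \<subseteq> Ar \<union> Delta11_C" by (auto simp: Ar_def)
next
  fix M :: "(nat, nat, unit) struct" and e r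
  assume M: "models M (Ar \<union> Delta11_C)"
  then interpret pa_model M
    by unfold_locales (auto simp: models_Un Ar_def)
  have "sat M e r (delta11_ax () \<phi> \<psi>)" if "no_set_quant \<phi>" "no_set_quant \<psi>" for \<phi> \<psi> e r
    using that by (intro modelsD[OF M]) (auto simp: Delta11_C_def)
  then have "models M AC_unique"
    by (auto simp: models_def AC_unique_def intro: delta11_imp_choice)
  with M have "models M (Ar \<union> AC_unique)" by (simp add: models_Un)
  with assms show "sat M e r \<phi>"
    unfolding provable_def by (rule soundness) simp
qed


section \<open>The interpretation of \<open>SA\<close>\<close>

text \<open>\<open>Imp Bot Bot\<close> is a true formula, so relativising quantifiers to the domains
  leaves their range unchanged.\<close>

definition all_sets :: translation where
  "all_sets = Translation (\<lambda>_. Imp Bot Bot) (\<lambda>_. Mem (Var 0) () 0)"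

lemma wf_all_sets: "wf_translation all_sets"
  by (simp add: wf_translation_def all_sets_def)

definition spread :: "('n, 'd, unit) struct \<Rightarrow> ('n, 'd, 's) struct" where
  "spread M = Struct (zero_of M) (one_of M) (plus_of M) (times_of M) (\<lambda>a _. elem_of M a ())"

lemma spread_simps [simp]:
  "zero_of (spread M) = zero_of M" "one_of (spread M) = one_of M"
  "plus_of (spread M) = plus_of M" "times_of (spread M) = times_of M"
  "elem_of (spread M) a s x = elem_of M a () x"
  by (simp_all add: spread_def)

lemma teval_spread [simp]: "teval (spread M) e t = teval M e t"
  by (induction t) auto

lemma push_bind_sort:
  "(\<lambda>k' i. push () x r () (bind_sort k \<rho> k' i)) = push k x (\<lambda>k i. r () (\<rho> k i))"
  by (intro ext) (auto simp: push_def bind_sort_def split: nat.split)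

text \<open>Translating a formula amounts to reading the structure as many-sorted:
  \<open>bind_sort\<close> does to indices what \<open>push\<close> does to assignments.\<close>

lemma sat_trans_env:
  "sat M e r (trans_env all_sets \<rho> \<phi>) \<longleftrightarrow> sat (spread M) e (\<lambda>k i. r () (\<rho> k i)) \<phi>"
  by (induction \<phi> arbitrary: e r \<rho>) (simp_all add: all_sets_def push_bind_sort del: push_same)

lemma no_set_quant_trans_env: "no_set_quant \<phi> \<Longrightarrow> no_set_quant (trans_env all_sets \<rho> \<phi>)"
  by (induction \<phi> arbitrary: \<rho>) (auto simp: all_sets_def)

lemma models_spread:
  assumes M: "models M (Ar \<union> AC_unique)"
  shows "models (spread M) SA"
  unfolding models_def
proof (intro ballI allI)
  fix \<chi> e and r :: "nat \<Rightarrow> nat \<Rightarrow> 'b"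
  \<comment> \<open>An assignment for all sorts has to be packed into one for the single sort of
    \<open>M\<close>; coding sort and index together as one index does this, so that
    \<open>r\<close> is recovered from \<open>r'\<close>.\<close>
  define \<rho> :: "nat \<Rightarrow> nat \<Rightarrow> nat" where "\<rho> k i = prod_encode (k, i)" for k i
  define r' :: "unit \<Rightarrow> nat \<Rightarrow> 'b" where "r' u n = r (fst (prod_decode n)) (snd (prod_decode n))" for u n
  have r': "(\<lambda>k i. r' () (\<rho> k i)) = r" by (simp add: r'_def \<rho>_def)
  have trans0: "sat (spread M) e r \<phi> \<longleftrightarrow> sat M e r' (trans_env all_sets \<rho> \<phi>)" for e \<phi>
    by (simp add: sat_trans_env r')
  have trans: "sat (spread M) e (push k x r) \<phi> \<longleftrightarrow>
      sat M e (push () x r') (trans_env all_sets (bind_sort k \<rho>) \<phi>)" for e k x \<phi>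
    by (simp only: sat_trans_env push_bind_sort r')
  assume "\<chi> \<in> SA"
  then consider "\<chi> \<in> peano" | \<phi> where "\<chi> = induction_ax \<phi>"
    | k \<phi> where "\<chi> = comprehension_ax k \<phi>" "no_set_quant \<phi>"
    | k \<phi> where "\<chi> = choice_ax k (Suc k) \<phi>" "no_set_quant \<phi>"
    by (auto simp: SA_def k_simple_def)
  then show "sat (spread M) e r \<chi>"
  proof cases
    case 1
    \<comment> \<open>The Peano axioms contain no set variables, so they are translated to
      themselves.\<close>
    then have "trans_env all_sets \<rho> \<chi> \<in> peano"
      by (auto simp: peano_def Neg_def)
    then show ?thesis
      unfolding trans0 by (intro modelsD[OF M]) (auto simp: Ar_def)
  next
    case 2
    interpret pa_model M
      using M by unfold_locales (auto simp: models_Un Ar_def)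
    have step: "(\<lambda>i. teval M (case_nat a e) (case i of 0 \<Rightarrow> Add (Var 0) One | Suc j \<Rightarrow> Var (Suc j)))
        = case_nat (plus_of M a (one_of M)) e" for a
      by (rule ext) (simp split: nat.split)
    show ?thesis
      unfolding 2 using induct[of e r' "trans_env all_sets \<rho> \<phi>"]
      by (simp add: induction_ax_def sat_subst trans0[symmetric] step)
  next
    case 3
    then have "sat M e r' (comprehension_ax () (trans_env all_sets \<rho> \<phi>))"
      by (intro modelsD[OF M]) (auto simp: Ar_def intro: no_set_quant_trans_env)
    then show ?thesis
      by (simp add: 3 sat_comprehension_ax trans0)
  next
    case 4
    \<comment> \<open>Under \<open>bind_sort k \<rho>\<close> the distinguished set variable keeps
      index 0 while the parameters move up. Sorts \<open>k\<close> and \<open>Suc k\<close> both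
      become the only sort, so the axiom turns into an instance of \<open>AC_unique\<close>.\<close>
    then have "sat M e r' (choice_ax () () (trans_env all_sets (bind_sort k \<rho>) \<phi>))"
      by (intro modelsD[OF M]) (auto simp: AC_unique_def intro: no_set_quant_trans_env)
    then show ?thesis
      by (simp add: 4 sat_choice_ax sat_Ex1S trans is_pair_def)
  qed
qed

lemma derives_closure:
  assumes "T \<turnstile> \<phi>"
  shows "T \<turnstile> closure \<phi>"
proof -
  have N: "T \<turnstile> (AllN ^^ n) \<phi>" for n
    by (induction n) (use assms in \<open>auto simp: provable_def intro: derives.AllNI\<close>)
  have S: "T \<turnstile> \<psi> \<Longrightarrow> T \<turnstile> (AllS s ^^ n) \<psi>" for s n \<psi>
    by (induction n) (auto simp: provable_def intro: derives.AllSI)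
  have "T \<turnstile> \<psi> \<Longrightarrow> T \<turnstile> fold (\<lambda>s. AllS s ^^ f s) ss \<psi>" for f ss \<psi>
    by (induction ss arbitrary: \<psi>) (auto intro: S)
  with N show ?thesis by (simp add: closure_def)
qed

text \<open>Derivations are not translated step by step: soundness for \<open>SA\<close> is applied
  in \<open>spread M\<close>, and completeness brings the result back to
  \<open>Ar \<union> AC_unique\<close>.\<close>

lemma SA_interpretable:
  assumes "SA \<turnstile> \<phi>"
  shows "Ar \<union> AC_unique \<turnstile> translate all_sets (closure \<phi>)"
proof (rule completeness)
  show "peano \<subseteq> Ar \<union> AC_unique" by (auto simp: Ar_def)
next
  fix M :: "(nat, nat, unit) struct" and e r
  assume "models M (Ar \<union> AC_unique)"
  then have "models (spread M) SA" by (rule models_spread)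
  with derives_closure[OF assms]
  have "sat (spread M) e (\<lambda>k i. r () (prod_encode (k, i))) (closure \<phi>)"
    unfolding provable_def by (rule soundness) simp
  then show "sat M e r (translate all_sets (closure \<phi>))"
    by (simp add: translate_def sat_trans_env)
qed

theorem theorem5:
  shows "(\<exists>I. wf_translation I \<and>
           (\<forall>\<phi> :: sa_fm. SA \<turnstile> \<phi> \<longrightarrow> Ar \<union> AC_unique \<turnstile> translate I (closure \<phi>)))
       \<and> (\<forall>\<phi> :: ar_fm. Ar \<union> AC_unique \<turnstile> \<phi> \<longrightarrow> Ar \<union> Delta11_C \<turnstile> \<phi>)"
  using wf_all_sets SA_interpretable Ar_AC_unique_subset_Delta11_C by blast

end
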